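(* Let $\mathbb{F}$ be a field of characteristic zero and let $(L,\varphi)$ be a finite-dimensional quadratic Lie algebra over $\mathbb{F}$ with no simple ideals. Let $R$ be the solvable radical of $L$, let $S$ be a Levi factor of $L$ (so $L=S\oplus R$), and let $R^\perp=\{x\in L:\varphi(x,R)=0\}$. Then $R^\perp\subseteq R$. Moreover, define $\hat{\varphi}(x+R^\perp,y+R^\perp)=\varphi(x,y)$ for $x,y\in R$, and define the Lie homomorphism $\Phi_S\colon S\to\operatorname{Der}_{\hat\varphi}(R/R^\perp)$ by $\Phi_S(x)(y+R^\perp)=[x,y]+R^\perp$. Then $L$ is isomorphic (as a Lie algebra) to the double extension $(R/R^\perp)_S=S\oplus R/R^\perp\oplus S^*$ of $(R/R^\perp,\hat\varphi)$ by $(S,\Phi_S)$, with bilinear form $\hat\varphi_S$. Furthermore, $L$ is isometrically isomorphic to $(R/R^\perp)_S$ when the latter is endowed with the bilinear form $\hat\varphi_S+\phi$, where $\phi$ is the symmetric bilinear form on $(R/R^\perp)_S$ with $\phi|_{S\times S}=\varphi|_{S\times S}$ and $\phi(u,v)=0$ whenever $u\in R/R^\perp\oplus S^*$ (and $v\in (R/R^\perp)_S$ arbitrary).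
   Context: A quadratic Lie algebra is a Lie algebra $L$ with a nondegenerate symmetric bilinear form $\varphi$ that is invariant: $\varphi([x,y],z)+\varphi(y,[x,z])=0$ for all $x,y,z$. For a quadratic Lie algebra $(V,\psi)$, $\operatorname{Der}_\psi(V)$ denotes the Lie algebra of derivations $d$ of $V$ that are skew-adjoint for $\psi$, i.e. $\psi(d(x),x')+\psi(x,d(x'))=0$. Double extension: given a quadratic Lie algebra $(V,\psi)$, a Lie algebra $B$ and a Lie homomorphism $\phi_0\colon B\to\operatorname{Der}_\psi(V)$, the double extension of $(V,\psi)$ by $(B,\phi_0)$ is the vector space $V_B=B\oplus V\oplus B^*$ with bracket $[b+x+\beta,\,b'+x'+\beta']=[b,b']+\phi_0(b)(x')-\phi_0(b')(x)+[x,x']+w(x,x')+\beta\circ\operatorname{ad}b'-\beta'\circ\operatorname{ad}b$, where $w(x,x')\in B^*$ is given by $w(x,x')(b)=\psi(\phi_0(b)(x),x')$, and with the symmetric bilinear form $\psi_B(b+x+\beta,\,b'+x'+\beta')=\beta(b')+\beta'(b)+\psi(x,x')$ (for $b,b'\in B$, $x,x'\in V$, $\beta,\beta'\in B^*$). In the theorem, $V=R/R^\perp$, $\psi=\hat\varphi$, $B=S$, $\phi_0=\Phi_S$, and $\hat\varphi_S$ denotes the resulting form $\psi_B$. All vector spaces are finite dimensional and the field has characteristic zero. *)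

theory Defs
  imports Complex_Main
begin

text \<open>The ambient Lie algebra L is the whole type 'v, a vector space over the field 'k
  with scalar multiplication scale, bracket br and (for quadratic ones) a form phi.\<close>

definition fin_dim :: "('k::field \<Rightarrow> 'v::ab_group_add \<Rightarrow> 'v) \<Rightarrow> bool" where
  "fin_dim scale \<longleftrightarrow> (\<exists>B. finite B \<and> module.span scale B = UNIV)"

definition lie_algebra :: "('k::field \<Rightarrow> 'v::ab_group_add \<Rightarrow> 'v) \<Rightarrow> ('v \<Rightarrow> 'v \<Rightarrow> 'v) \<Rightarrow> bool" where
  "lie_algebra scale br \<longleftrightarrow>
     vector_space scale \<and>
     (\<forall>x. Vector_Spaces.linear scale scale (br x)) \<and>
     (\<forall>y. Vector_Spaces.linear scale scale (\<lambda>x. br x y)) \<and>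
     (\<forall>x. br x x = 0) \<and>
     (\<forall>x y z. br x (br y z) + br y (br z x) + br z (br x y) = 0)"

definition quadratic_lie_algebra ::
  "('k::field \<Rightarrow> 'v::ab_group_add \<Rightarrow> 'v) \<Rightarrow> ('v \<Rightarrow> 'v \<Rightarrow> 'v) \<Rightarrow> ('v \<Rightarrow> 'v \<Rightarrow> 'k) \<Rightarrow> bool" where
  "quadratic_lie_algebra scale br phi \<longleftrightarrow>
     lie_algebra scale br \<and>
     (\<forall>x. Vector_Spaces.linear scale (*) (phi x)) \<and>
     (\<forall>x y. phi x y = phi y x) \<and>
     (\<forall>x. (\<forall>y. phi x y = 0) \<longrightarrow> x = 0) \<and>
     (\<forall>x y z. phi (br x y) z + phi y (br x z) = 0)"

definition lie_subalgebra :: "('k::field \<Rightarrow> 'v::ab_group_add \<Rightarrow> 'v) \<Rightarrow> ('v \<Rightarrow> 'v \<Rightarrow> 'v) \<Rightarrow> 'v set \<Rightarrow> bool" where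
  "lie_subalgebra scale br S \<longleftrightarrow> module.subspace scale S \<and> (\<forall>x\<in>S. \<forall>y\<in>S. br x y \<in> S)"

definition lie_ideal :: "('k::field \<Rightarrow> 'v::ab_group_add \<Rightarrow> 'v) \<Rightarrow> ('v \<Rightarrow> 'v \<Rightarrow> 'v) \<Rightarrow> 'v set \<Rightarrow> bool" where
  "lie_ideal scale br I \<longleftrightarrow> module.subspace scale I \<and> (\<forall>x. \<forall>y\<in>I. br x y \<in> I)"

fun derived_series :: "('k::field \<Rightarrow> 'v::ab_group_add \<Rightarrow> 'v) \<Rightarrow> ('v \<Rightarrow> 'v \<Rightarrow> 'v) \<Rightarrow> 'v set \<Rightarrow> nat \<Rightarrow> 'v set" where
  "derived_series scale br I 0 = I"
| "derived_series scale br I (Suc n) =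
     module.span scale {br x y | x y. x \<in> derived_series scale br I n \<and> y \<in> derived_series scale br I n}"

definition solvable :: "('k::field \<Rightarrow> 'v::ab_group_add \<Rightarrow> 'v) \<Rightarrow> ('v \<Rightarrow> 'v \<Rightarrow> 'v) \<Rightarrow> 'v set \<Rightarrow> bool" where
  "solvable scale br I \<longleftrightarrow> (\<exists>n. derived_series scale br I n = {0})"

definition is_solvable_radical :: "('k::field \<Rightarrow> 'v::ab_group_add \<Rightarrow> 'v) \<Rightarrow> ('v \<Rightarrow> 'v \<Rightarrow> 'v) \<Rightarrow> 'v set \<Rightarrow> bool" where
  "is_solvable_radical scale br R \<longleftrightarrow>
     lie_ideal scale br R \<and> solvable scale br R \<and>
     (\<forall>I. lie_ideal scale br I \<and> solvable scale br I \<longrightarrow> I \<subseteq> R)"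

definition is_levi_factor :: "('k::field \<Rightarrow> 'v::ab_group_add \<Rightarrow> 'v) \<Rightarrow> ('v \<Rightarrow> 'v \<Rightarrow> 'v) \<Rightarrow> 'v set \<Rightarrow> 'v set \<Rightarrow> bool" where
  "is_levi_factor scale br R S \<longleftrightarrow>
     lie_subalgebra scale br S \<and> S \<inter> R = {0} \<and> (\<forall>x. \<exists>s\<in>S. \<exists>r\<in>R. x = s + r)"

definition simple_ideal :: "('k::field \<Rightarrow> 'v::ab_group_add \<Rightarrow> 'v) \<Rightarrow> ('v \<Rightarrow> 'v \<Rightarrow> 'v) \<Rightarrow> 'v set \<Rightarrow> bool" where
  "simple_ideal scale br I \<longleftrightarrow>
     lie_ideal scale br I \<and> (\<exists>x\<in>I. \<exists>y\<in>I. br x y \<noteq> 0) \<and>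
     (\<forall>J. module.subspace scale J \<and> J \<subseteq> I \<and> (\<forall>x\<in>I. \<forall>y\<in>J. br x y \<in> J)
          \<longrightarrow> J = {0} \<or> J = I)"

definition orth :: "('v \<Rightarrow> 'v \<Rightarrow> 'k::field) \<Rightarrow> 'v set \<Rightarrow> 'v set" where
  "orth phi A = {x. \<forall>a\<in>A. phi x a = 0}"

definition qclass :: "'v set \<Rightarrow> 'v::ab_group_add \<Rightarrow> 'v set" where
  "qclass W x = (\<lambda>w. x + w) ` W"

definition quotient_space :: "'v::ab_group_add set \<Rightarrow> 'v set \<Rightarrow> 'v set set" where
  "quotient_space R W = qclass W ` R"

definition qadd :: "'v::ab_group_add set \<Rightarrow> 'v set \<Rightarrow> 'v set" where
  "qadd X Y = {x + y | x y. x \<in> X \<and> y \<in> Y}"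

definition qscale :: "('k::field \<Rightarrow> 'v::ab_group_add \<Rightarrow> 'v) \<Rightarrow> 'v set \<Rightarrow> 'k \<Rightarrow> 'v set \<Rightarrow> 'v set" where
  "qscale scale W c X = {scale c x + w | x w. x \<in> X \<and> w \<in> W}"

definition qneg :: "('k::field \<Rightarrow> 'v::ab_group_add \<Rightarrow> 'v) \<Rightarrow> 'v set \<Rightarrow> 'v set \<Rightarrow> 'v set" where
  "qneg scale W X = qscale scale W (-1) X"

definition qbr :: "('v \<Rightarrow> 'v \<Rightarrow> 'v) \<Rightarrow> 'v::ab_group_add set \<Rightarrow> 'v set \<Rightarrow> 'v set \<Rightarrow> 'v set" where
  "qbr br W X Y = {br x y + w | x y w. x \<in> X \<and> y \<in> Y \<and> w \<in> W}"

definition qform :: "('v \<Rightarrow> 'v \<Rightarrow> 'k) \<Rightarrow> 'v set \<Rightarrow> 'v set \<Rightarrow> 'k" where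
  "qform phi X Y = phi (SOME x. x \<in> X) (SOME y. y \<in> Y)"

definition PhiS :: "('v \<Rightarrow> 'v \<Rightarrow> 'v) \<Rightarrow> 'v::ab_group_add set \<Rightarrow> 'v \<Rightarrow> 'v set \<Rightarrow> 'v set" where
  "PhiS br W a X = {br a y + w | y w. y \<in> X \<and> w \<in> W}"

text \<open>B is a subalgebra (subspace of 'v with bracket brB); B^* is represented by the
  linear functionals on B, extended by 0 outside B (so that representatives are unique).
  V is a carrier Vq of type 'q with operations vadd, vscale, vzero, vbr and form psi.
  The representation phi0 : B \<rightarrow> Der(V) is given as a function 'v \<Rightarrow> 'q \<Rightarrow> 'q.\<close>

definition dual_space :: "('k::field \<Rightarrow> 'v::ab_group_add \<Rightarrow> 'v) \<Rightarrow> 'v set \<Rightarrow> ('v \<Rightarrow> 'k) set" where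
  "dual_space scale B =
     {\<beta>. (\<forall>x\<in>B. \<forall>y\<in>B. \<beta> (x + y) = \<beta> x + \<beta> y) \<and>
          (\<forall>c. \<forall>x\<in>B. \<beta> (scale c x) = c * \<beta> x) \<and>
          (\<forall>x. x \<notin> B \<longrightarrow> \<beta> x = 0)}"

definition dext_carrier :: "('k::field \<Rightarrow> 'v::ab_group_add \<Rightarrow> 'v) \<Rightarrow> 'v set \<Rightarrow> 'q set
    \<Rightarrow> ('v \<times> 'q \<times> ('v \<Rightarrow> 'k)) set" where
  "dext_carrier scale B Vq = {(b, x, \<beta>). b \<in> B \<and> x \<in> Vq \<and> \<beta> \<in> dual_space scale B}"

definition dext_add :: "('q \<Rightarrow> 'q \<Rightarrow> 'q) \<Rightarrow> ('v::ab_group_add \<times> 'q \<times> ('v \<Rightarrow> 'k::field))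
    \<Rightarrow> ('v \<times> 'q \<times> ('v \<Rightarrow> 'k)) \<Rightarrow> ('v \<times> 'q \<times> ('v \<Rightarrow> 'k))" where
  "dext_add vadd u u' =
     (case u of (b, x, \<beta>) \<Rightarrow> case u' of (b', x', \<beta>') \<Rightarrow>
        (b + b', vadd x x', \<lambda>t. \<beta> t + \<beta>' t))"

definition dext_scale :: "('k::field \<Rightarrow> 'v::ab_group_add \<Rightarrow> 'v) \<Rightarrow> ('k \<Rightarrow> 'q \<Rightarrow> 'q) \<Rightarrow> 'k
    \<Rightarrow> ('v \<times> 'q \<times> ('v \<Rightarrow> 'k)) \<Rightarrow> ('v \<times> 'q \<times> ('v \<Rightarrow> 'k))" where
  "dext_scale scale vscale c u =
     (case u of (b, x, \<beta>) \<Rightarrow> (scale c b, vscale c x, \<lambda>t. c * \<beta> t))"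

definition dext_br :: "'v set \<Rightarrow> ('v \<Rightarrow> 'v \<Rightarrow> 'v) \<Rightarrow> ('q \<Rightarrow> 'q \<Rightarrow> 'q) \<Rightarrow> ('q \<Rightarrow> 'q)
    \<Rightarrow> ('q \<Rightarrow> 'q \<Rightarrow> 'q) \<Rightarrow> ('q \<Rightarrow> 'q \<Rightarrow> 'k::field) \<Rightarrow> ('v \<Rightarrow> 'q \<Rightarrow> 'q)
    \<Rightarrow> ('v::ab_group_add \<times> 'q \<times> ('v \<Rightarrow> 'k)) \<Rightarrow> ('v \<times> 'q \<times> ('v \<Rightarrow> 'k)) \<Rightarrow> ('v \<times> 'q \<times> ('v \<Rightarrow> 'k))" where
  "dext_br B brB vadd vneg vbr psi phi0 u u' =
     (case u of (b, x, \<beta>) \<Rightarrow> case u' of (b', x', \<beta>') \<Rightarrow>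
        (brB b b',
         vadd (vadd (phi0 b x') (vneg (phi0 b' x))) (vbr x x'),
         \<lambda>c. if c \<in> B then psi (phi0 c x) x' + \<beta> (brB b' c) - \<beta>' (brB b c) else 0))"

definition dext_form :: "('q \<Rightarrow> 'q \<Rightarrow> 'k::field)
    \<Rightarrow> ('v \<times> 'q \<times> ('v \<Rightarrow> 'k)) \<Rightarrow> ('v \<times> 'q \<times> ('v \<Rightarrow> 'k)) \<Rightarrow> 'k" where
  "dext_form psi u u' =
     (case u of (b, x, \<beta>) \<Rightarrow> case u' of (b', x', \<beta>') \<Rightarrow> \<beta> b' + \<beta>' b + psi x x')"

text \<open>The symmetric bilinear form on B \<oplus> V \<oplus> B^* that agrees with phi on B \<times> B and
  vanishes as soon as one argument lies in V \<oplus> B^*: necessarily (b,x,beta),(b',x',beta') \<mapsto> phi(b,b').\<close>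
definition S_part_form :: "('v \<Rightarrow> 'v \<Rightarrow> 'k)
    \<Rightarrow> ('v \<times> 'q \<times> ('v \<Rightarrow> 'k)) \<Rightarrow> ('v \<times> 'q \<times> ('v \<Rightarrow> 'k)) \<Rightarrow> 'k" where
  "S_part_form phi u u' = phi (fst u) (fst u')"

end

theory Submission
  imports Defs "Jordan_Normal_Form.Jordan_Normal_Form_Existence" "Jordan_Normal_Form.DL_Rank"
    "HOL-Algebra.Algebraic_Closure_Type"
begin

text \<open>
  The isomorphism is explicit: if \<open>x = s + r\<close> with \<open>s \<in> S\<close> and \<open>r \<in> R\<close>, send \<open>x\<close> to
  \<open>(s, r + R\<^sup>\<bottom>, \<phi>(r, \<cdot>)|\<^sub>S)\<close>. Once \<open>R\<^sup>\<bottom> \<subseteq> R\<close> is known, invariance of the form gives the bracket and the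
  metric, and nondegeneracy gives bijectivity.

  For \<open>R\<^sup>\<bottom> \<subseteq> R\<close>, note that \<open>[R, R\<^sup>\<bottom>] = 0\<close> and suppose that some ideal \<open>I \<subseteq> R\<^sup>\<bottom>\<close> is not
  contained in \<open>R\<close>; take one of least dimension. Then \<open>I = [I, I]\<close>. The radical \<open>N\<close> of the trace form
  \<open>K(x, y) = tr (ad x ad y)|\<^sub>I\<close> on \<open>I\<close> is an ideal of \<open>L\<close>, hence \<open>N = I\<close> or \<open>N \<subseteq> R\<close>. In the second case
  every functional \<open>K(l, \<cdot>)\<close> on \<open>I\<close> has the form \<open>K(u, \<cdot>)\<close> with \<open>u \<in> I\<close>, and \<open>l - u\<close> centralizes \<open>I\<close>; so \<open>L\<close>
  is the sum of \<open>I\<close> and its centralizer. Nondegeneracy of \<open>\<phi>\<close> then yields \<open>I \<inter> R = 0\<close>, and ideals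
  of \<open>I\<close> are ideals of \<open>L\<close>, so \<open>I\<close> is simple, which is excluded.

  The case \<open>N = I\<close> contradicts Cartan's criterion: for \<open>x \<in> I\<close> consider the Jordan form of \<open>ad x\<close> over the
  algebraic closure, with eigenvalues \<open>a\<^sub>i\<close>. For a \<open>\<rat>\<close>-linear \<open>f\<close> with rational values, the operator
  multiplying the generalized eigenspace of \<open>a\<close> by \<open>f(a)\<close> is a derivation \<open>D\<close>; since \<open>x\<close> is a sum of
  commutators and \<open>K = 0\<close>, we get \<open>0 = tr (ad x D) = \<Sum> a\<^sub>i f(a\<^sub>i)\<close>, and applying \<open>f\<close> shows \<open>f(a\<^sub>i) = 0\<close>. Hence all
  \<open>ad x\<close> are nilpotent, and by Engel's argument \<open>I\<close> has an ideal of codimension one containing \<open>[I, I]\<close>.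
\<close>

(* HOL-Algebra makes X a keyword, which would clash with the variable X in the theorem. *)
no_notation var (\<open>X\<index>\<close>)

section \<open>Jordan form over an algebraically closed field\<close>

text \<open>Completing \<open>v\<close> to a basis and taking these vectors as columns gives a
  matrix of full rank.\<close>

lemma invertible_matrix_first_column:
  fixes v :: "'a::field vec"
  assumes v: "v \<in> carrier_vec n" and v0: "v \<noteq> 0\<^sub>v n"
  obtains W W' where "W \<in> carrier_mat n n" "W' \<in> carrier_mat n n"
    "W * W' = 1\<^sub>m n" "W' * W = 1\<^sub>m n" "col W 0 = v"
proof -
  interpret vec_space "TYPE('a)" n .
  note bc = basis_completion[OF v v0]
  have n0: "n \<noteq> 0" using v v0 by auto
  define W where "W = mat_of_cols n (basis_completion v)"
  have W: "W \<in> carrier_mat n n" unfolding W_def using bc(6) by auto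
  have cols: "cols W = basis_completion v"
    unfolding W_def using bc(2) by simp
  have "rank W = n" using lin_indpt_full_rank[OF W] cols bc(4,5) by simp
  then have "det W \<noteq> 0" using det_rank_iff[OF W] by simp
  from det_non_zero_imp_unit[OF W this, of undefined]
  obtain W' where W': "W' \<in> carrier_mat n n" "W * W' = 1\<^sub>m n" "W' * W = 1\<^sub>m n"
    unfolding Units_def ring_mat_def by auto
  have "col W 0 = cols W ! 0" using W n0 by (simp add: cols_nth)
  also have "\<dots> = v" unfolding cols using bc(6,7) n0 by (cases "basis_completion v") auto
  finally show thesis using that W W' by blast
qed

text \<open>Induction on the dimension: moving an eigenvector to the first position clears the rest
  of the first column, and the remaining block is triangularized by the induction
  hypothesis.\<close>

lemma triangularizable_alg_closed:
  fixes A :: "'a::alg_closed_field mat"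
  assumes "A \<in> carrier_mat n n"
  shows "\<exists>B \<in> carrier_mat n n. upper_triangular B \<and> similar_mat A B"
  using assms
proof (induction n arbitrary: A)
  case 0
  then show ?case using similar_mat_refl[OF 0] by (intro bexI[of _ A]) auto
next
  case (Suc n A)
  note A = Suc.prems
  have "Polynomial.degree (char_poly A) > 0" using degree_monic_char_poly[OF A] by simp
  then obtain e where "eigenvalue A e"
    using alg_closed_imp_poly_has_root eigenvalue_root_char_poly[OF A] by blast
  then obtain v where v: "v \<in> carrier_vec (Suc n)" "v \<noteq> 0\<^sub>v (Suc n)" "A *\<^sub>v v = e \<cdot>\<^sub>v v"
    unfolding eigenvalue_def eigenvector_def using A by auto
  obtain W W' where W: "W \<in> carrier_mat (Suc n) (Suc n)" "W' \<in> carrier_mat (Suc n) (Suc n)"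
    "W * W' = 1\<^sub>m (Suc n)" "W' * W = 1\<^sub>m (Suc n)" "col W 0 = v"
    using invertible_matrix_first_column[OF v(1,2)] by metis
  define A' where "A' = W' * A * W"
  have A': "A' \<in> carrier_mat (Suc n) (Suc n)" unfolding A'_def using A W by auto
  have sim: "similar_mat A A'"
  proof -
    have "similar_mat_wit A' A W' W"
      by (rule similar_mat_witI[of _ _ "Suc n"]) (use W A A' in \<open>auto simp: A'_def\<close>)
    then show ?thesis using similar_mat_sym unfolding similar_mat_def by blast
  qed
  \<comment> \<open>\<open>W\<close> sends the first unit vector to the eigenvector \<open>v\<close>
    and \<open>W'\<close> sends \<open>v\<close> back, so the first column of \<open>A'\<close> is
    \<open>e\<close> times that unit vector.\<close>
  have "A' = W' * (A * W)" unfolding A'_def using W A by (simp add: assoc_mult_mat[of _ "Suc n" "Suc n"])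
  then have "col A' 0 = W' *\<^sub>v (A *\<^sub>v v)"
    using col_mult2[OF W(2) mult_carrier_mat[OF A W(1)], of 0] col_mult2[OF A W(1), of 0] W(5) by simp
  also have "\<dots> = e \<cdot>\<^sub>v (W' *\<^sub>v v)" using v W by (simp add: mult_mat_vec)
  also have "W' *\<^sub>v v = col (W' * W) 0" using col_mult2[OF W(2,1), of 0] W(5) by simp
  also have "\<dots> = unit_vec (Suc n) 0" using W(4) by simp
  finally have col0: "col A' 0 = e \<cdot>\<^sub>v unit_vec (Suc n) 0" .
  have A'0: "A' $$ (i, 0) = 0" if "0 < i" "i < Suc n" for i
    using arg_cong[OF col0, of "\<lambda>u. vec_index u i"] A' that by (simp add: unit_vec_def)
  obtain A1 A2 A0 A3 where split: "split_block A' 1 1 = (A1, A2, A0, A3)"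
    by (metis prod_cases4)
  have dims: "dim_row A' = 1 + n" "dim_col A' = 1 + n" using A' by auto
  note sb = split_block[OF split dims]
  have A0: "A0 = 0\<^sub>m n 1"
    using split[unfolded split_block_def Let_def] A'0 A' by auto
  from Suc.IH[OF sb(4)] obtain B P Q where B: "B \<in> carrier_mat n n" "upper_triangular B"
      "similar_mat_wit A3 B P Q"
    unfolding similar_mat_def by blast
  note PQ = similar_mat_witD2[OF sb(4) B(3)]
  \<comment> \<open>Conjugation by the block diagonal matrix of \<open>1\<close> and
    \<open>P\<close> turns \<open>A3\<close> into \<open>B\<close>; the corner \<open>A2\<close>
    gets multiplied by \<open>P\<close>.\<close>
  define C where "C = four_block_mat A1 (A2 * P) A0 B"
  have "similar_mat_wit A' C (four_block_mat (1\<^sub>m 1) (0\<^sub>m 1 n) (0\<^sub>m n 1) P)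
      (four_block_mat (1\<^sub>m 1) (0\<^sub>m 1 n) (0\<^sub>m n 1) Q)"
    unfolding sb(5) C_def
  proof (rule similar_mat_wit_four_block[OF similar_mat_wit_refl[OF sb(1)] B(3) _ _ sb(1) sb(4) sb(3)])
    have "A2 * P * Q = A2" using sb(2) PQ by (subst assoc_mult_mat[of _ 1 n _ n _ n]) auto
    then show "A2 = 1\<^sub>m 1 * (A2 * P) * Q" using sb(2) PQ by simp
    show "A0 = P * A0 * 1\<^sub>m 1" unfolding A0 using PQ by simp
    show "A2 * P \<in> carrier_mat 1 n" using sb(2) PQ by simp
  qed
  then have "similar_mat A C" using similar_mat_trans[OF sim] unfolding similar_mat_def by blast
  moreover have "upper_triangular C" unfolding C_def A0
    by (rule upper_triangular_four_block[OF sb(1) B(1) _ B(2)]) (use sb(1) in auto)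
  moreover have "C \<in> carrier_mat (Suc n) (Suc n)" unfolding C_def using four_block_carrier_mat[OF sb(1) B(1)] by simp
  ultimately show ?case by blast
qed

text \<open>Nonzero entries lie inside a single Jordan block, on or just above its diagonal. What
  matters later is the triangular shape and the invariance of the generalized eigenspaces.\<close>

lemma jordan_matrix_entry:
  assumes "i < sum_list (map fst n_as)" "j < sum_list (map fst n_as)"
    and "jordan_matrix n_as $$ (i, j) \<noteq> (0::'a::field)"
  shows "i \<le> j \<and> jordan_matrix n_as $$ (i, i) = jordan_matrix n_as $$ (j, j)"
  using assms
proof (induction n_as arbitrary: i j)
  case (Cons na n_as)
  obtain n a where na: "na = (n, a)" by force
  let ?s = "sum_list (map fst n_as)"
  have J: "jordan_matrix (na # n_as) =
      four_block_mat (jordan_block n a) (0\<^sub>m n ?s) (0\<^sub>m ?s n) (jordan_matrix n_as)"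
    unfolding jordan_matrix_def na by (simp add: Let_def jordan_matrix_def[symmetric])
  have entry: "jordan_matrix (na # n_as) $$ (k, l) =
      (if k < n then if l < n then jordan_block n a $$ (k, l) else 0
       else if l < n then 0 else jordan_matrix n_as $$ (k - n, l - n))"
    if "k < n + ?s" "l < n + ?s" for k l
    using that unfolding J by auto
  have ij: "i < n + ?s" "j < n + ?s" using Cons.prems(1,2) na by auto
  show ?case
  proof (cases "i < n \<or> j < n")
    case True
    then show ?thesis using Cons.prems(3) ij by (simp add: entry jordan_block_def split: if_splits)
  next
    case False
    then have "i - n \<le> j - n \<and> jordan_matrix n_as $$ (i - n, i - n) = jordan_matrix n_as $$ (j - n, j - n)"
      using Cons.prems(3) ij by (intro Cons.IH) (auto simp: entry)
    then show ?thesis using False ij by (simp add: entry) arith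
  qed
qed auto

lemma jordan_nf_alg_closed:
  fixes A :: "'a::alg_closed_field mat"
  assumes A: "A \<in> carrier_mat n n"
  obtains B P Q where "similar_mat_wit A B P Q"
    "\<And>i j. i < n \<Longrightarrow> j < n \<Longrightarrow> B $$ (i, j) \<noteq> 0 \<Longrightarrow> i \<le> j \<and> B $$ (i, i) = B $$ (j, j)"
proof -
  obtain C where C: "C \<in> carrier_mat n n" "upper_triangular C" "similar_mat A C"
    using triangularizable_alg_closed[OF A] by blast
  from triangular_to_jnf_vector[OF C(1,2)] have "similar_mat A (jordan_matrix (triangular_to_jnf_vector C))"
    using similar_mat_trans[OF C(3)] unfolding jordan_nf_def by blast
  then obtain P Q where PQ: "similar_mat_wit A (jordan_matrix (triangular_to_jnf_vector C)) P Q"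
    unfolding similar_mat_def by blast
  have "sum_list (map fst (triangular_to_jnf_vector C)) = n"
    using similar_mat_witD2(5)[OF A PQ] by auto
  then show thesis using that[OF PQ] jordan_matrix_entry by metis
qed

section \<open>Nilpotency from vanishing trace forms\<close>

text \<open>The field is a vector space over \<open>rat\<close>, in which \<open>{a}\<close> is
  independent; the map sending \<open>a\<close> to \<open>1\<close> extends to a linear
  functional.\<close>

lemma rat_functional_nonzero:
  fixes a :: "'a::field_char_0"
  assumes "a \<noteq> 0"
  obtains f :: "'a \<Rightarrow> rat" where "\<And>x y. f (x + y) = f x + f y"
    "\<And>q x. f (of_rat q * x) = q * f x" "f a \<noteq> 0"
proof -
  interpret V: vector_space "\<lambda>q x. of_rat q * (x::'a)"
    by standard (simp_all add: algebra_simps of_rat_add of_rat_mult)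
  interpret Q: vector_space "(*) :: rat \<Rightarrow> rat \<Rightarrow> rat"
    by standard (simp_all add: algebra_simps)
  interpret VQ: vector_space_pair "\<lambda>q x. of_rat q * (x::'a)" "(*) :: rat \<Rightarrow> rat \<Rightarrow> rat" ..
  have "V.independent {a}" using assms V.dependent_single by blast
  then obtain f where f: "Vector_Spaces.linear (\<lambda>q x. of_rat q * (x::'a)) (*) f" "f a = 1"
    using VQ.linear_independent_extend[of "{a}" "\<lambda>_. 1"] by auto
  interpret L: Vector_Spaces.linear "\<lambda>q x. of_rat q * (x::'a)" "(*)" f by (rule f)
  show thesis using that[of f] L.add L.scale f(2) by simp
qed

text \<open>With \<open>b i l j\<close> the \<open>l\<close>-th coordinate of \<open>[p\<^sub>i, p\<^sub>j]\<close> in a Jordan basis \<open>p\<close> of a derivation \<open>J\<close>, this is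
  the grading of the algebra by generalized eigenspaces; the triangular shape of \<open>J\<close> lets the
  coordinate equations be solved recursively.\<close>

lemma structure_constants_weights:
  fixes J :: "nat \<Rightarrow> nat \<Rightarrow> 'a::field" and b :: "nat \<Rightarrow> nat \<Rightarrow> nat \<Rightarrow> 'a"
  assumes tri: "\<And>i j. i < n \<Longrightarrow> j < n \<Longrightarrow> J i j \<noteq> 0 \<Longrightarrow> i \<le> j \<and> J i i = J j j"
    and der: "\<And>i j l. i < n \<Longrightarrow> j < n \<Longrightarrow> l < n \<Longrightarrow>
      (\<Sum>m<n. J l m * b i m j) = (\<Sum>m<n. b i l m * J m j) + (\<Sum>m<n. J m i * b m l j)"
    and "i < n" "j < n" "l < n" "J l l \<noteq> J i i + J j j"
  shows "b i l j = 0"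
  using assms(3-)
\<comment> \<open>A nonzero off-diagonal \<open>J l m\<close> forces \<open>l < m\<close>, and a
  nonzero \<open>J m j\<close> or \<open>J m i\<close> forces \<open>m < j\<close> or
  \<open>m < i\<close>. Replacing the index keeps the diagonal value and lowers this measure, so the
  three off-diagonal sums vanish.\<close>
proof (induction "i + j + (n - l)" arbitrary: i j l rule: less_induct)
  case less
  have 1: "(\<Sum>m\<in>{..<n}-{l}. J l m * b i m j) = 0"
  proof (rule sum.neutral, rule ballI)
    fix m assume m: "m \<in> {..<n} - {l}"
    show "J l m * b i m j = 0"
    proof (cases "J l m = 0")
      case False
      then have "l < m" "J m m = J l l" using tri[of l m] m less.prems by auto
      then have "b i m j = 0" using m less.prems by (intro less.hyps) auto
      then show ?thesis by simp
    qed simp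
  qed
  have 2: "(\<Sum>m\<in>{..<n}-{j}. b i l m * J m j) = 0"
  proof (rule sum.neutral, rule ballI)
    fix m assume m: "m \<in> {..<n} - {j}"
    show "b i l m * J m j = 0"
    proof (cases "J m j = 0")
      case False
      then have "m < j" "J m m = J j j" using tri[of m j] m less.prems by auto
      then have "b i l m = 0" using m less.prems by (intro less.hyps) auto
      then show ?thesis by simp
    qed simp
  qed
  have 3: "(\<Sum>m\<in>{..<n}-{i}. J m i * b m l j) = 0"
  proof (rule sum.neutral, rule ballI)
    fix m assume m: "m \<in> {..<n} - {i}"
    show "J m i * b m l j = 0"
    proof (cases "J m i = 0")
      case False
      then have "m < i" "J m m = J i i" using tri[of m i] m less.prems by auto
      then have "b m l j = 0" using m less.prems by (intro less.hyps) auto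
      then show ?thesis by simp
    qed simp
  qed
  have "J l l * b i l j = b i l j * J j j + J i i * b i l j"
    using der[OF less.prems(1,2,3)] less.prems 1 2 3
    by (simp add: sum.remove[of "{..<n}" l "\<lambda>m. J l m * b i m j"]
        sum.remove[of "{..<n}" j "\<lambda>m. b i l m * J m j"] sum.remove[of "{..<n}" i "\<lambda>m. J m i * b m l j"])
  then have "(J l l - (J i i + J j j)) * b i l j = 0" by (simp add: algebra_simps)
  then show ?case using less.prems(4) by simp
qed

section \<open>Traces and strictly triangular matrices\<close>

definition mtrace :: "'a::comm_ring_1 mat \<Rightarrow> 'a" where
  "mtrace A = (\<Sum>i<dim_row A. A $$ (i, i))"

lemma mtrace_mult:
  assumes "A \<in> carrier_mat n m" "B \<in> carrier_mat m n"
  shows "mtrace (A * B) = (\<Sum>i<n. \<Sum>k<m. A $$ (i, k) * B $$ (k, i))"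
  using assms by (auto simp: mtrace_def scalar_prod_def atLeast0LessThan intro!: sum.cong)

lemma mtrace_comm:
  assumes "A \<in> carrier_mat n m" "B \<in> carrier_mat m n"
  shows "mtrace (A * B) = mtrace (B * A)"
  unfolding mtrace_mult[OF assms] mtrace_mult[OF assms(2,1)]
  by (subst sum.swap) (simp add: mult.commute)

lemma mtrace_diff:
  assumes "A \<in> carrier_mat n n" "B \<in> carrier_mat n n"
  shows "mtrace (A - B) = mtrace A - mtrace B"
  using assms by (auto simp: mtrace_def sum_subtractf)

text \<open>Both sides contain tr(ABE), and cyclicity turns tr(BAE) into tr(AEB). This invariance of
  the trace form serves both for the weight operator below and for \<open>kil\<close>.\<close>

lemma mtrace_commutator_mult:
  assumes A: "A \<in> carrier_mat n n" and B: "B \<in> carrier_mat n n" and E: "E \<in> carrier_mat n n"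
  shows "mtrace ((A * B - B * A) * E) = mtrace (A * (B * E - E * B))"
proof -
  have "mtrace ((A * B - B * A) * E) = mtrace (A * B * E) - mtrace (B * A * E)"
    using A B E by (subst minus_mult_distrib_mat[of _ n n]) (auto intro!: mtrace_diff)
  also have "mtrace (A * B * E) = mtrace (A * (B * E))" using A B E by simp
  also have "mtrace (B * A * E) = mtrace (B * (A * E))" using A B E by simp
  also have "\<dots> = mtrace (A * E * B)" using A B E by (intro mtrace_comm) auto
  also have "\<dots> = mtrace (A * (E * B))" using A B E by simp
  also have "mtrace (A * (B * E)) - mtrace (A * (E * B)) = mtrace (A * (B * E) - A * (E * B))"
    using A B E by (intro mtrace_diff[symmetric]) auto
  also have "A * (B * E) - A * (E * B) = A * (B * E - E * B)"
    using A B E by (intro mult_minus_distrib_mat[symmetric]) auto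
  finally show ?thesis .
qed

text \<open>Each further factor pushes the possible nonzero entries one diagonal further up; after
  \<open>n\<close> factors none remain.\<close>

lemma strict_upper_nilpotent:
  fixes J :: "'a::comm_ring_1 mat"
  assumes J: "J \<in> carrier_mat n n"
    and up: "\<And>i j. i < n \<Longrightarrow> j < n \<Longrightarrow> J $$ (i, j) \<noteq> 0 \<Longrightarrow> i < j"
  shows "J ^\<^sub>m n = 0\<^sub>m n n"
proof -
  have *: "(J ^\<^sub>m k) $$ (i, j) = 0" if "i < n" "j < n" "j < i + k" for i j k
    using that
  proof (induction k arbitrary: i j)
    case (Suc k)
    have "(J ^\<^sub>m Suc k) $$ (i, j) = (\<Sum>m<n. (J ^\<^sub>m k) $$ (i, m) * J $$ (m, j))"
      using J Suc.prems pow_carrier_mat[OF J, of k] by (simp add: scalar_prod_def atLeast0LessThan)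
    also have "\<dots> = 0"
    proof (rule sum.neutral, rule ballI)
      fix m assume m: "m \<in> {..<n}"
      show "(J ^\<^sub>m k) $$ (i, m) * J $$ (m, j) = 0"
      proof (cases "m < i + k")
        case True then show ?thesis using Suc.IH[of i m] Suc.prems m by simp
      next
        case False
        then have "J $$ (m, j) = 0" using up[of m j] Suc.prems m by fastforce
        then show ?thesis by simp
      qed
    qed
    finally show ?case .
  qed (use J in auto)
  have c: "J ^\<^sub>m n \<in> carrier_mat n n" using J by simp
  show ?thesis by (rule eq_matI) (use c * in auto)
qed

section \<open>Linear combinations of a family of matrices\<close>

definition lincomb_mat :: "nat \<Rightarrow> (nat \<Rightarrow> 'a::comm_ring_1 mat) \<Rightarrow> (nat \<Rightarrow> 'a) \<Rightarrow> 'a mat" where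
  "lincomb_mat n C w = mat n n (\<lambda>(k, l). \<Sum>m<n. w m * C m $$ (k, l))"

lemma lincomb_mat_carrier [simp]: "lincomb_mat n C w \<in> carrier_mat n n"
  by (simp add: lincomb_mat_def)

lemma lincomb_mat_index [simp]:
  "k < n \<Longrightarrow> l < n \<Longrightarrow> lincomb_mat n C w $$ (k, l) = (\<Sum>m<n. w m * C m $$ (k, l))"
  by (simp add: lincomb_mat_def)

lemma lincomb_mat_dim [simp]: "dim_row (lincomb_mat n C w) = n" "dim_col (lincomb_mat n C w) = n"
  by (simp_all add: lincomb_mat_def)

lemma lincomb_mat_cong:
  "(\<And>m. m < n \<Longrightarrow> w m = w' m) \<Longrightarrow> (\<And>m. m < n \<Longrightarrow> C m = C' m) \<Longrightarrow>
   lincomb_mat n C w = lincomb_mat n C' w'"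
  by (auto simp: lincomb_mat_def intro!: sum.cong)

lemma mult_lincomb_mat:
  assumes U: "U \<in> carrier_mat n n" and C: "\<And>m. m < n \<Longrightarrow> C m \<in> carrier_mat n n"
  shows "U * lincomb_mat n C w = lincomb_mat n (\<lambda>m. U * C m) w"
proof (rule eq_matI)
  fix k l assume kl: "k < dim_row (lincomb_mat n (\<lambda>m. U * C m) w)" "l < dim_col (lincomb_mat n (\<lambda>m. U * C m) w)"
  then have "(U * lincomb_mat n C w) $$ (k, l) = (\<Sum>p<n. \<Sum>m<n. w m * (U $$ (k, p) * C m $$ (p, l)))"
    using U by (simp add: scalar_prod_def atLeast0LessThan sum_distrib_left mult.left_commute)
  also have "\<dots> = (\<Sum>m<n. \<Sum>p<n. w m * (U $$ (k, p) * C m $$ (p, l)))" by (rule sum.swap)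
  also have "\<dots> = (\<Sum>m<n. w m * (U * C m) $$ (k, l))"
  proof (rule sum.cong[OF refl])
    fix m assume "m \<in> {..<n}"
    then have "C m \<in> carrier_mat n n" using C by simp
    then show "(\<Sum>p<n. w m * (U $$ (k, p) * C m $$ (p, l))) = w m * (U * C m) $$ (k, l)"
      using U kl by (simp add: scalar_prod_def atLeast0LessThan sum_distrib_left)
  qed
  finally show "(U * lincomb_mat n C w) $$ (k, l) = lincomb_mat n (\<lambda>m. U * C m) w $$ (k, l)"
    using kl by simp
qed (use U in auto)

lemma lincomb_mat_mult:
  assumes U: "U \<in> carrier_mat n n" and C: "\<And>m. m < n \<Longrightarrow> C m \<in> carrier_mat n n"
  shows "lincomb_mat n C w * U = lincomb_mat n (\<lambda>m. C m * U) w"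
proof (rule eq_matI)
  fix k l assume kl: "k < dim_row (lincomb_mat n (\<lambda>m. C m * U) w)" "l < dim_col (lincomb_mat n (\<lambda>m. C m * U) w)"
  then have "(lincomb_mat n C w * U) $$ (k, l) = (\<Sum>p<n. \<Sum>m<n. w m * (C m $$ (k, p) * U $$ (p, l)))"
    using U by (simp add: scalar_prod_def atLeast0LessThan sum_distrib_right mult.assoc)
  also have "\<dots> = (\<Sum>m<n. \<Sum>p<n. w m * (C m $$ (k, p) * U $$ (p, l)))" by (rule sum.swap)
  also have "\<dots> = (\<Sum>m<n. w m * (C m * U) $$ (k, l))"
  proof (rule sum.cong[OF refl])
    fix m assume "m \<in> {..<n}"
    then have "C m \<in> carrier_mat n n" using C by simp
    then show "(\<Sum>p<n. w m * (C m $$ (k, p) * U $$ (p, l))) = w m * (C m * U) $$ (k, l)"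
      using U kl by (simp add: scalar_prod_def atLeast0LessThan sum_distrib_left)
  qed
  finally show "(lincomb_mat n C w * U) $$ (k, l) = lincomb_mat n (\<lambda>m. C m * U) w $$ (k, l)"
    using kl by simp
qed (use U in auto)

lemma lincomb_mat_commutator:
  assumes U: "U \<in> carrier_mat n n" and C: "\<And>m. m < n \<Longrightarrow> C m \<in> carrier_mat n n"
  shows "U * lincomb_mat n C w - lincomb_mat n C w * U = lincomb_mat n (\<lambda>m. U * C m - C m * U) w"
proof -
  have *: "U * lincomb_mat n C w = lincomb_mat n (\<lambda>m. U * C m) w"
    "lincomb_mat n C w * U = lincomb_mat n (\<lambda>m. C m * U) w"
    using U C by (simp_all add: mult_lincomb_mat lincomb_mat_mult)
  show ?thesis unfolding *
  proof (rule eq_matI)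
    fix k l assume kl: "k < dim_row (lincomb_mat n (\<lambda>m. U * C m - C m * U) w)"
      "l < dim_col (lincomb_mat n (\<lambda>m. U * C m - C m * U) w)"
    have "(U * C m - C m * U) $$ (k, l) = (U * C m) $$ (k, l) - (C m * U) $$ (k, l)" if "m < n" for m
      using U C[OF that] kl by (intro index_minus_mat) auto
    then show "(lincomb_mat n (\<lambda>m. U * C m) w - lincomb_mat n (\<lambda>m. C m * U) w) $$ (k, l) =
        lincomb_mat n (\<lambda>m. U * C m - C m * U) w $$ (k, l)"
      using kl by (simp add: sum_subtractf[symmetric] right_diff_distrib)
  qed auto
qed

text \<open>Nesting multiplies the coefficient vector by a matrix. This is how a change of basis
  acts on the index of a family of adjoint matrices.\<close>

lemma lincomb_mat_lincomb_mat:
  "lincomb_mat n (\<lambda>k. lincomb_mat n C (\<lambda>m. a m k)) w = lincomb_mat n C (\<lambda>m. \<Sum>k<n. a m k * w k)"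
proof (rule eq_matI)
  fix i j assume ij: "i < dim_row (lincomb_mat n C (\<lambda>m. \<Sum>k<n. a m k * w k))"
    "j < dim_col (lincomb_mat n C (\<lambda>m. \<Sum>k<n. a m k * w k))"
  have "(\<Sum>k<n. \<Sum>m<n. w k * (a m k * C m $$ (i, j))) = (\<Sum>m<n. \<Sum>k<n. w k * (a m k * C m $$ (i, j)))"
    by (rule sum.swap)
  then show "lincomb_mat n (\<lambda>k. lincomb_mat n C (\<lambda>m. a m k)) w $$ (i, j) =
      lincomb_mat n C (\<lambda>m. \<Sum>k<n. a m k * w k) $$ (i, j)"
    using ij by (simp add: sum_distrib_left sum_distrib_right mult_ac)
qed auto

lemma mtrace_mult_lincomb_mat:
  assumes U: "U \<in> carrier_mat n n" and C: "\<And>m. m < n \<Longrightarrow> C m \<in> carrier_mat n n"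
  shows "mtrace (U * lincomb_mat n C w) = (\<Sum>m<n. w m * mtrace (U * C m))"
proof -
  have "mtrace (U * lincomb_mat n C w) = (\<Sum>i<n. \<Sum>m<n. w m * (U * C m) $$ (i, i))"
    using U C by (simp add: mult_lincomb_mat) (simp add: mtrace_def)
  also have "\<dots> = (\<Sum>m<n. \<Sum>i<n. w m * (U * C m) $$ (i, i))" by (rule sum.swap)
  also have "\<dots> = (\<Sum>m<n. w m * mtrace (U * C m))"
    using U by (simp add: mtrace_def sum_distrib_left)
  finally show ?thesis .
qed

text \<open>Cartan's criterion in coordinates. \<open>C i\<close> stands for ad e_i in a basis e and
  \<open>A\<close> for ad x: \<open>der\<close> says that [x, e_i] has its coordinates in column
  \<open>i\<close> of \<open>A\<close>, \<open>tr0\<close> that the trace form vanishes, and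
  \<open>comm\<close> that ad x is a combination of commutators. The proof shows that all
  eigenvalues of \<open>A\<close> are zero.\<close>

lemma traceless_structure_constants_nilpotent:
  fixes A :: "'a::{alg_closed_field, field_char_0} mat"
  assumes A: "A \<in> carrier_mat n n" and C: "\<And>i. i < n \<Longrightarrow> C i \<in> carrier_mat n n"
    and der: "\<And>i. i < n \<Longrightarrow> A * C i - C i * A = lincomb_mat n C (\<lambda>m. A $$ (m, i))"
    and tr0: "\<And>i j. i < n \<Longrightarrow> j < n \<Longrightarrow> mtrace (C i * C j) = 0"
    and comm: "\<And>k l. k < n \<Longrightarrow> l < n \<Longrightarrow>
      A $$ (k, l) = (\<Sum>i<n. \<Sum>j<n. t i j * (C i * C j - C j * C i) $$ (k, l))"
  shows "A ^\<^sub>m n = 0\<^sub>m n n"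
proof -
  obtain J P Q where wit: "similar_mat_wit A J P Q"
    and tri: "\<And>i j. i < n \<Longrightarrow> j < n \<Longrightarrow> J $$ (i, j) \<noteq> 0 \<Longrightarrow> i \<le> j \<and> J $$ (i, i) = J $$ (j, j)"
    using jordan_nf_alg_closed[OF A] by metis
  note w = similar_mat_witD2[OF A wit]
  note PQ = w(1) and QP = w(2) and J = w(5) and P = w(6) and Q = w(7)
  have assoc: "U * Y * Z = U * (Y * Z)"
    if "U \<in> carrier_mat n n" "Y \<in> carrier_mat n n" "Z \<in> carrier_mat n n" for U Y Z :: "'a mat"
    using that by (rule assoc_mult_mat)
  have QP_cancel: "Q * (P * U) = U" and PQ_cancel: "P * (Q * U) = U" if "U \<in> carrier_mat n n" for U
    using that P Q PQ QP by (simp_all add: assoc[symmetric])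
  have QA: "Q * A = J * Q" and AP: "A * P = P * J"
    using P Q J PQ QP by (simp_all add: w(3) assoc QP_cancel)
  define C' where "C' m = Q * C m * P" for m
  have C': "C' m \<in> carrier_mat n n" if "m < n" for m unfolding C'_def using C that P Q by auto
  have sandwich: "Q * (U * Y - Y * U) * P = (Q * U * P) * (Q * Y * P) - (Q * Y * P) * (Q * U * P)"
    if "U \<in> carrier_mat n n" "Y \<in> carrier_mat n n" for U Y
    using that P Q by (simp add: mult_minus_distrib_mat[of _ n n _ n] minus_mult_distrib_mat[of _ n n _ _ n] assoc PQ_cancel)
  have J': "J = Q * A * P" using P Q J QP by (simp add: QA assoc)
  \<comment> \<open>The operators are now written in the Jordan basis formed by the columns of
    \<open>P\<close>, but the index \<open>i\<close> still counts the old basis, so the coefficients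
    are still those of \<open>A\<close>.\<close>
  have der': "J * C' i - C' i * J = lincomb_mat n C' (\<lambda>m. A $$ (m, i))" if "i < n" for i
  proof -
    have "J * C' i - C' i * J = Q * (A * C i - C i * A) * P"
      unfolding C'_def J' by (rule sandwich[OF A C[OF that], symmetric])
    also have "\<dots> = lincomb_mat n C' (\<lambda>m. A $$ (m, i))"
      unfolding der[OF that] C'_def using P Q C
      by (simp add: mult_lincomb_mat lincomb_mat_mult)
    finally show ?thesis .
  qed
  \<comment> \<open>\<open>B i\<close> stands for ad p_i, where p_i is column \<open>i\<close> of
    \<open>P\<close>; its entries are the structure constants in the Jordan basis.\<close>
  define B where "B i = lincomb_mat n C' (\<lambda>m. P $$ (m, i))" for i
  have B: "B i \<in> carrier_mat n n" for i unfolding B_def by simp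
  have prod_index: "(U * Y) $$ (k, l) = (\<Sum>m<n. U $$ (k, m) * Y $$ (m, l))"
    if "U \<in> carrier_mat n n" "Y \<in> carrier_mat n n" "k < n" "l < n" for U Y :: "'a mat" and k l
    using that by (simp add: scalar_prod_def atLeast0LessThan)
  have derB: "J * B i - B i * J = lincomb_mat n B (\<lambda>m. J $$ (m, i))" if i: "i < n" for i
  proof -
    have "J * B i - B i * J = lincomb_mat n (\<lambda>m. lincomb_mat n C' (\<lambda>p. A $$ (p, m))) (\<lambda>m. P $$ (m, i))"
      unfolding B_def using J C' by (subst lincomb_mat_commutator) (auto intro!: lincomb_mat_cong der')
    also have "\<dots> = lincomb_mat n C' (\<lambda>p. (A * P) $$ (p, i))"
      unfolding lincomb_mat_lincomb_mat by (rule lincomb_mat_cong) (use A P i in \<open>simp_all add: prod_index del: index_mult_mat\<close>)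
    also have "\<dots> = lincomb_mat n C' (\<lambda>p. \<Sum>m<n. P $$ (p, m) * J $$ (m, i))"
      unfolding AP by (rule lincomb_mat_cong) (use J P i in \<open>simp_all add: prod_index del: index_mult_mat\<close>)
    also have "\<dots> = lincomb_mat n B (\<lambda>m. J $$ (m, i))"
      unfolding B_def lincomb_mat_lincomb_mat ..
    finally show ?thesis .
  qed
  have weight: "B i $$ (l, j) = 0"
    if "i < n" "j < n" "l < n" "J $$ (l, l) \<noteq> J $$ (i, i) + J $$ (j, j)" for i j l
  proof (rule structure_constants_weights[where J = "\<lambda>i j. J $$ (i, j)" and b = "\<lambda>i l j. B i $$ (l, j)" and n = n])
    fix i j l assume ijl: "i < n" "j < n" "l < n"
    have "(J * B i) $$ (l, j) - (B i * J) $$ (l, j) = lincomb_mat n B (\<lambda>m. J $$ (m, i)) $$ (l, j)"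
      unfolding derB[OF ijl(1), symmetric] using J B[of i] ijl by simp
    then show "(\<Sum>m<n. J $$ (l, m) * B i $$ (m, j)) =
        (\<Sum>m<n. B i $$ (l, m) * J $$ (m, j)) + (\<Sum>m<n. J $$ (m, i) * B m $$ (l, j))"
      using ijl J B by (simp add: prod_index algebra_simps del: index_mult_mat)
  qed (use tri that in auto)
  have B_C': "C' i = lincomb_mat n B (\<lambda>m. Q $$ (m, i))" if i: "i < n" for i
  proof -
    have "lincomb_mat n B (\<lambda>m. Q $$ (m, i)) = lincomb_mat n C' (\<lambda>p. \<Sum>m<n. P $$ (p, m) * Q $$ (m, i))"
      unfolding B_def lincomb_mat_lincomb_mat ..
    also have "\<dots> = lincomb_mat n C' (\<lambda>p. if p = i then 1 else 0)"
    proof (rule lincomb_mat_cong)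
      fix p assume "p < n"
      then show "(\<Sum>m<n. P $$ (p, m) * Q $$ (m, i)) = (if p = i then 1 else 0)"
        using prod_index[OF P Q, of p i] i PQ by simp
    qed simp
    also have "\<dots> = C' i"
      by (rule eq_matI) (use C'[OF i] i in \<open>auto simp: if_distrib[of "\<lambda>x. x * _"] cong: if_cong\<close>)
    finally show ?thesis by simp
  qed
  have tr_orth: "(\<Sum>i<n. J $$ (i, i) * of_rat (f (J $$ (i, i)))) = 0"
    if add: "\<And>x y. f (x + y) = f x + f y" for f :: "'a \<Rightarrow> rat"
  proof -
    define d where "d i = (of_rat (f (J $$ (i, i))) :: 'a)" for i
    \<comment> \<open>\<open>D\<close> multiplies each Jordan basis vector by the value of
      \<open>f\<close> at its eigenvalue.\<close>
    define D where "D = mat n n (\<lambda>(i, j). if i = j then d i else 0)"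
    have D: "D \<in> carrier_mat n n" unfolding D_def by simp
    have DB: "D * B i - B i * D = d i \<cdot>\<^sub>m B i" if i: "i < n" for i
    proof (rule eq_matI)
      fix l j assume "l < dim_row (d i \<cdot>\<^sub>m B i)" "j < dim_col (d i \<cdot>\<^sub>m B i)"
      then have lj: "l < n" "j < n" using B[of i] by auto
      have 1: "(D * B i) $$ (l, j) = d l * B i $$ (l, j)"
        using prod_index[OF D B lj, of i] lj
        by (simp add: D_def if_distrib[of "\<lambda>x. x * _"] cong: if_cong)
      have 2: "(B i * D) $$ (l, j) = d j * B i $$ (l, j)"
        using prod_index[OF B D lj, of i] lj
        by (simp add: D_def if_distrib[of "\<lambda>x. _ * x"] mult.commute cong: if_cong)
      \<comment> \<open>At a nonzero entry, \<open>weight\<close> relates the eigenvalues and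
        additivity of \<open>f\<close> gives \<open>d l = d i + d j\<close>. This is the derivation
        property of \<open>D\<close>.\<close>
      have "(d l - d j) * B i $$ (l, j) = d i * B i $$ (l, j)"
      proof (cases "J $$ (l, l) = J $$ (i, i) + J $$ (j, j)")
        case True
        then show ?thesis unfolding d_def by (simp add: add of_rat_add)
      next
        case False
        then show ?thesis using weight[OF i lj(2,1)] by simp
      qed
      moreover have "(D * B i - B i * D) $$ (l, j) = (D * B i) $$ (l, j) - (B i * D) $$ (l, j)"
        using D B[of i] lj by (intro index_minus_mat) auto
      ultimately show "(D * B i - B i * D) $$ (l, j) = (d i \<cdot>\<^sub>m B i) $$ (l, j)"
        using lj B[of i] 1 2 by (simp add: algebra_simps)
    qed (use D B[of i] in auto)
    \<comment> \<open>\<open>D\<close> only rescales the \<open>B m\<close>, and these span the same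
      matrices as the \<open>C' m\<close>; so bracketing with \<open>D\<close> stays in that
      span.\<close>
    have DC': "\<exists>u. D * C' i - C' i * D = lincomb_mat n C' u" if i: "i < n" for i
    proof -
      have "D * C' i - C' i * D = lincomb_mat n (\<lambda>m. d m \<cdot>\<^sub>m B m) (\<lambda>m. Q $$ (m, i))"
        unfolding B_C'[OF i] using D B by (subst lincomb_mat_commutator) (auto intro!: lincomb_mat_cong DB)
      also have "\<dots> = lincomb_mat n B (\<lambda>m. d m * Q $$ (m, i))"
        by (rule eq_matI) (use B in \<open>auto simp: B_def algebra_simps\<close>)
      also have "\<dots> = lincomb_mat n C' (\<lambda>p. \<Sum>m<n. P $$ (p, m) * (d m * Q $$ (m, i)))"
        unfolding B_def lincomb_mat_lincomb_mat ..
      finally show ?thesis by blast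
    qed
    define E where "E = P * D * Q"
    have E: "E \<in> carrier_mat n n" unfolding E_def using P D Q by auto
    have CE: "\<exists>u. C i * E - E * C i = lincomb_mat n C u" if i: "i < n" for i
    proof -
      obtain u where u: "D * C' i - C' i * D = lincomb_mat n C' u" using DC'[OF i] by blast
      have PC': "P * C' m * Q = C m" if "m < n" for m
        unfolding C'_def using C[OF that] P Q PQ by (simp add: assoc PQ_cancel)
      have "E * C i - C i * E = P * (D * C' i - C' i * D) * Q"
        unfolding E_def PC'[OF i, symmetric] using P Q D C'[OF i]
        by (simp add: mult_minus_distrib_mat[of _ n n _ n] minus_mult_distrib_mat[of _ n n _ _ n] assoc QP_cancel)
      also have "\<dots> = lincomb_mat n (\<lambda>m. P * C' m * Q) u"
        unfolding u using P Q C' by (simp add: mult_lincomb_mat lincomb_mat_mult)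
      also have "\<dots> = lincomb_mat n C u" by (rule lincomb_mat_cong) (simp_all add: PC')
      finally have "- (E * C i - C i * E) = - lincomb_mat n C u" by simp
      moreover have "- (E * C i - C i * E) = C i * E - E * C i"
        by (rule eq_matI) (use E C[OF i] in auto)
      moreover have "- lincomb_mat n C u = lincomb_mat n C (\<lambda>m. - u m)"
        by (rule eq_matI) (auto simp: sum_negf)
      ultimately show ?thesis by metis
    qed
    \<comment> \<open>Invariance of the trace moves \<open>E\<close> into a commutator with
      \<open>C j\<close>; this is a combination of the \<open>C m\<close>, whose traces against
      \<open>C i\<close> vanish by \<open>tr0\<close>.\<close>
    have trCE: "mtrace ((C i * C j - C j * C i) * E) = 0" if ij: "i < n" "j < n" for i j
    proof -
      obtain u where u: "C j * E - E * C j = lincomb_mat n C u" using CE[OF ij(2)] by blast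
      show ?thesis
        unfolding mtrace_commutator_mult[OF C[OF ij(1)] C[OF ij(2)] E] u
        using mtrace_mult_lincomb_mat[OF C[OF ij(1)] C] tr0[OF ij(1)] by simp
    qed
    have "mtrace (A * E) = (\<Sum>k<n. \<Sum>l<n. A $$ (k, l) * E $$ (l, k))"
      by (rule mtrace_mult[OF A E])
    also have "\<dots> = (\<Sum>k<n. \<Sum>l<n. \<Sum>i<n. \<Sum>j<n. t i j * ((C i * C j - C j * C i) $$ (k, l) * E $$ (l, k)))"
      by (intro sum.cong refl) (simp add: comm sum_distrib_right mult.assoc)
    also have "\<dots> = (\<Sum>k<n. \<Sum>i<n. \<Sum>l<n. \<Sum>j<n. t i j * ((C i * C j - C j * C i) $$ (k, l) * E $$ (l, k)))"
      by (intro sum.cong refl sum.swap)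
    also have "\<dots> = (\<Sum>i<n. \<Sum>k<n. \<Sum>l<n. \<Sum>j<n. t i j * ((C i * C j - C j * C i) $$ (k, l) * E $$ (l, k)))"
      by (rule sum.swap)
    also have "\<dots> = (\<Sum>i<n. \<Sum>k<n. \<Sum>j<n. \<Sum>l<n. t i j * ((C i * C j - C j * C i) $$ (k, l) * E $$ (l, k)))"
      by (intro sum.cong refl sum.swap)
    also have "\<dots> = (\<Sum>i<n. \<Sum>j<n. \<Sum>k<n. \<Sum>l<n. t i j * ((C i * C j - C j * C i) $$ (k, l) * E $$ (l, k)))"
      by (intro sum.cong refl sum.swap)
    also have "\<dots> = (\<Sum>i<n. \<Sum>j<n. t i j * mtrace ((C i * C j - C j * C i) * E))"
    proof (intro sum.cong refl)
      fix i j assume "i \<in> {..<n}" "j \<in> {..<n}"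
      then have "C i * C j - C j * C i \<in> carrier_mat n n" using C[of i] C[of j] by auto
      from mtrace_mult[OF this E]
      show "(\<Sum>k<n. \<Sum>l<n. t i j * ((C i * C j - C j * C i) $$ (k, l) * E $$ (l, k))) =
          t i j * mtrace ((C i * C j - C j * C i) * E)"
        by (simp add: sum_distrib_left)
    qed
    also have "\<dots> = 0" by (simp add: trCE)
    finally have "mtrace (A * E) = 0" .
    \<comment> \<open>In the Jordan basis the same trace is the sum of the eigenvalues times their
      images under \<open>f\<close>.\<close>
    moreover have "mtrace (A * E) = mtrace (J * D)"
    proof -
      have "mtrace (A * E) = mtrace (A * (P * D) * Q)" unfolding E_def using A P D Q by (simp add: assoc)
      also have "\<dots> = mtrace (Q * (A * (P * D)))" using A P D Q by (intro mtrace_comm[of _ n n]) auto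
      also have "Q * (A * (P * D)) = J * D" unfolding J' using A P D Q by (simp add: assoc)
      finally show ?thesis .
    qed
    moreover have "mtrace (J * D) = (\<Sum>i<n. J $$ (i, i) * d i)"
      unfolding mtrace_mult[OF J D]
      by (simp add: D_def if_distrib[of "\<lambda>x. _ * x"] cong: if_cong)
    ultimately show ?thesis unfolding d_def by simp
  qed
  have J0: "J $$ (i, i) = 0" if i: "i < n" for i
  proof (rule ccontr)
    assume "J $$ (i, i) \<noteq> 0"
    then obtain f :: "'a \<Rightarrow> rat" where f: "\<And>x y. f (x + y) = f x + f y"
      "\<And>q x. f (of_rat q * x) = q * f x" "f (J $$ (i, i)) \<noteq> 0"
      using rat_functional_nonzero by blast
    have f0: "f 0 = 0" using f(2)[of 0 0] by simp
    have fsum: "f (sum g S) = (\<Sum>x\<in>S. f (g x))" if "finite S" for g and S :: "nat set"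
      using that by (induction S) (auto simp: f0 f(1))
    \<comment> \<open>Applying \<open>f\<close> once more yields a sum of squares of rationals, all
      of which must vanish; this is why \<open>f\<close> takes rational values.\<close>
    have "0 = f (\<Sum>i<n. J $$ (i, i) * of_rat (f (J $$ (i, i))))"
      unfolding tr_orth[OF f(1)] f0 ..
    also have "\<dots> = (\<Sum>i<n. f (J $$ (i, i)) * f (J $$ (i, i)))"
      by (simp add: fsum mult.commute[of _ "of_rat _"] f(2))
    finally have "(\<Sum>i<n. f (J $$ (i, i)) * f (J $$ (i, i))) = 0" by simp
    then have "f (J $$ (i, i)) * f (J $$ (i, i)) = 0"
      using i by (subst (asm) sum_nonneg_eq_0_iff) auto
    then show False using f(3) by simp
  qed
  have "J ^\<^sub>m n = 0\<^sub>m n n"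
  proof (rule strict_upper_nilpotent[OF J])
    fix i j assume "i < n" "j < n" "J $$ (i, j) \<noteq> 0"
    then show "i < j" using tri[of i j] J0[of i] by (cases "i = j") auto
  qed
  then show ?thesis using similar_mat_wit_pow_id[OF wit, of n] P Q by simp
qed

section \<open>Adjoint matrices on an ideal\<close>

locale fin_dim_lie_algebra =
  fixes scale :: "'k::field_char_0 \<Rightarrow> 'v::ab_group_add \<Rightarrow> 'v" and br :: "'v \<Rightarrow> 'v \<Rightarrow> 'v"
  assumes fd: "fin_dim scale" and lie: "lie_algebra scale br"
begin

sublocale vector_space scale using lie unfolding lie_algebra_def by simp

definition lie_basis :: "'v set" where
  "lie_basis = (SOME B. finite B \<and> independent B \<and> span B = UNIV)"

lemma lie_basis: "finite lie_basis \<and> independent lie_basis \<and> span lie_basis = UNIV"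
proof -
  obtain B where B: "finite B" "span B = UNIV" using fd unfolding fin_dim_def by blast
  obtain B' where "B' \<subseteq> B" "independent B'" "B \<subseteq> span B'"
    using maximal_independent_subset[of B] by blast
  then have "finite B' \<and> independent B' \<and> span B' = UNIV"
    using B finite_subset span_mono[of B "span B'"] by (auto simp: span_span)
  then show ?thesis unfolding lie_basis_def by (rule someI)
qed

sublocale finite_dimensional_vector_space scale lie_basis
  using lie_basis by unfold_locales auto

lemma linear_br: "Vector_Spaces.linear scale scale (br x)"
  and linear_br_left: "Vector_Spaces.linear scale scale (\<lambda>x. br x y)"
  using lie unfolding lie_algebra_def by auto

lemma br_add_right: "br x (y + z) = br x y + br x z"
  and br_scale_right: "br x (scale c y) = scale c (br x y)"
  and br_diff_right: "br x (y - z) = br x y - br x z"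
  and br_zero_right [simp]: "br x 0 = 0"
  and br_sum_right: "br x (sum f A) = (\<Sum>a\<in>A. br x (f a))"
proof -
  interpret L: Vector_Spaces.linear scale scale "br x" by (rule linear_br)
  show "br x (y + z) = br x y + br x z" "br x (scale c y) = scale c (br x y)"
    "br x (y - z) = br x y - br x z" "br x 0 = 0" "br x (sum f A) = (\<Sum>a\<in>A. br x (f a))"
    by (fact L.add L.scale L.diff L.zero L.sum)+
qed

lemma br_add_left: "br (x + y) z = br x z + br y z"
  and br_scale_left: "br (scale c x) z = scale c (br x z)"
  and br_diff_left: "br (x - y) z = br x z - br y z"
  and br_zero_left [simp]: "br 0 z = 0"
  and br_sum_left: "br (sum f A) z = (\<Sum>a\<in>A. br (f a) z)"
proof -
  interpret L: Vector_Spaces.linear scale scale "\<lambda>x. br x z" by (rule linear_br_left)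
  show "br (x + y) z = br x z + br y z" "br (scale c x) z = scale c (br x z)"
    "br (x - y) z = br x z - br y z" "br 0 z = 0" "br (sum f A) z = (\<Sum>a\<in>A. br (f a) z)"
    by (fact L.add L.scale L.diff L.zero L.sum)+
qed

lemma br_self [simp]: "br x x = 0"
  using lie unfolding lie_algebra_def by simp

lemma br_commute: "br x y = - br y x"
proof -
  have "br y x + br x y = 0"
    using br_self[of "x + y"] unfolding br_add_left br_add_right by simp
  then show ?thesis by (simp add: eq_neg_iff_add_eq_0 add.commute)
qed

lemma br_minus_right: "br x (- y) = - br x y"
  using br_diff_right[of x 0 y] by simp

lemma jacobi: "br x (br y z) = br (br x y) z + br y (br x z)"
proof -
  have "br x (br y z) + br y (br z x) + br z (br x y) = 0"
    using lie unfolding lie_algebra_def by simp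
  moreover have "br y (br z x) = - br y (br x z)"
    using br_commute[of z x] by (simp add: br_minus_right)
  moreover have "br z (br x y) = - br (br x y) z" by (rule br_commute)
  ultimately show ?thesis by (simp add: algebra_simps)
qed

lemma br_br_left: "br (br x y) z = br x (br y z) - br y (br x z)"
  using jacobi[of x y z] by simp

definition bracket_span :: "'v set \<Rightarrow> 'v set \<Rightarrow> 'v set" where
  "bracket_span A B = span {br x y | x y. x \<in> A \<and> y \<in> B}"

lemma subspace_bracket_span: "subspace (bracket_span A B)"
  unfolding bracket_span_def by simp

lemma br_in_bracket_span: "x \<in> A \<Longrightarrow> y \<in> B \<Longrightarrow> br x y \<in> bracket_span A B"
  unfolding bracket_span_def by (rule span_base) auto

lemma bracket_span_subset:
  assumes "subspace D" "\<And>x y. x \<in> A \<Longrightarrow> y \<in> B \<Longrightarrow> br x y \<in> D"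
  shows "bracket_span A B \<subseteq> D"
  unfolding bracket_span_def by (rule span_minimal) (use assms in auto)

end

text \<open>An enumerated basis of \<open>I\<close> turns ad x on \<open>I\<close> into a matrix for
  every x of the whole algebra, not only for x in \<open>I\<close>.\<close>

locale lie_ideal_basis = fin_dim_lie_algebra scale br
  for scale :: "'k::field_char_0 \<Rightarrow> 'v::ab_group_add \<Rightarrow> 'v" and br :: "'v \<Rightarrow> 'v \<Rightarrow> 'v" +
  fixes I :: "'v set" and n :: nat and e :: "nat \<Rightarrow> 'v"
  assumes I_ideal: "lie_ideal scale br I"
    and e_inj: "inj_on e {..<n}"
    and e_indep: "independent (e ` {..<n})"
    and e_span: "span (e ` {..<n}) = I"
begin

lemma subspace_I: "subspace I" using I_ideal unfolding lie_ideal_def by simp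

lemma br_I: "y \<in> I \<Longrightarrow> br x y \<in> I" using I_ideal unfolding lie_ideal_def by simp

lemma e_I: "i < n \<Longrightarrow> e i \<in> I" using span_base[of "e i" "e ` {..<n}"] unfolding e_span by blast

definition coord :: "nat \<Rightarrow> 'v \<Rightarrow> 'k" where
  "coord i v = representation (e ` {..<n}) v (e i)"

lemma coord_add: "u \<in> I \<Longrightarrow> v \<in> I \<Longrightarrow> coord i (u + v) = coord i u + coord i v"
  unfolding coord_def using e_indep e_span by (simp add: representation_add)

lemma coord_scale: "u \<in> I \<Longrightarrow> coord i (scale c u) = c * coord i u"
  unfolding coord_def using e_indep e_span by (simp add: representation_scale)

lemma coord_diff: "u \<in> I \<Longrightarrow> v \<in> I \<Longrightarrow> coord i (u - v) = coord i u - coord i v"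
  unfolding coord_def using e_indep e_span by (simp add: representation_diff)

lemma coord_0 [simp]: "coord i 0 = 0"
  unfolding coord_def by (simp add: representation_zero)

lemma coord_sum: "(\<And>a. a \<in> A \<Longrightarrow> f a \<in> I) \<Longrightarrow> coord i (sum f A) = (\<Sum>a\<in>A. coord i (f a))"
proof (induction A rule: infinite_finite_induct)
  case (insert a A)
  then show ?case using subspace_sum[OF subspace_I, of A f] by (simp add: coord_add)
qed simp_all

lemma coord_expand: "v \<in> I \<Longrightarrow> v = (\<Sum>i<n. scale (coord i v) (e i))"
proof -
  assume v: "v \<in> I"
  have "(\<Sum>b\<in>e ` {..<n}. scale (representation (e ` {..<n}) v b) b) = v"
    using sum_representation_eq[OF e_indep, of v "e ` {..<n}"] v e_span by simp
  then show ?thesis unfolding coord_def by (simp add: sum.reindex[OF e_inj])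
qed

definition adm :: "'v \<Rightarrow> 'k mat" where
  "adm x = mat n n (\<lambda>(i, j). coord i (br x (e j)))"

lemma adm_carrier [simp]: "adm x \<in> carrier_mat n n" unfolding adm_def by simp

lemma adm_dim [simp]: "dim_row (adm x) = n" "dim_col (adm x) = n" unfolding adm_def by simp_all

lemma adm_index: "i < n \<Longrightarrow> j < n \<Longrightarrow> adm x $$ (i, j) = coord i (br x (e j))"
  unfolding adm_def by simp

lemma adm_index_add: "i < n \<Longrightarrow> j < n \<Longrightarrow> adm (x + y) $$ (i, j) = adm x $$ (i, j) + adm y $$ (i, j)"
  by (simp add: adm_index br_add_left coord_add br_I e_I)

lemma adm_index_scale: "i < n \<Longrightarrow> j < n \<Longrightarrow> adm (scale c x) $$ (i, j) = c * adm x $$ (i, j)"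
  by (simp add: adm_index br_scale_left coord_scale br_I e_I)

lemma adm_index_sum: "i < n \<Longrightarrow> j < n \<Longrightarrow> adm (sum f A) $$ (i, j) = (\<Sum>a\<in>A. adm (f a) $$ (i, j))"
  by (simp add: adm_index br_sum_left coord_sum br_I e_I)

lemma coord_br: "v \<in> I \<Longrightarrow> i < n \<Longrightarrow> coord i (br x v) = (\<Sum>k<n. adm x $$ (i, k) * coord k v)"
proof -
  assume v: "v \<in> I" and i: "i < n"
  have "coord i (br x v) = coord i (br x (\<Sum>k<n. scale (coord k v) (e k)))"
    using coord_expand[OF v] by simp
  also have "\<dots> = (\<Sum>k<n. coord k v * coord i (br x (e k)))"
    unfolding br_sum_right br_scale_right
    by (subst coord_sum) (auto simp: coord_scale br_I e_I intro!: subspace_scale[OF subspace_I])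
  finally show ?thesis using i by (simp add: adm_index mult.commute)
qed

lemma adm_br: "adm (br x y) = adm x * adm y - adm y * adm x"
proof (rule eq_matI)
  fix i j assume "i < dim_row (adm x * adm y - adm y * adm x)" "j < dim_col (adm x * adm y - adm y * adm x)"
  then have ij: "i < n" "j < n" by auto
  have "coord i (br (br x y) (e j)) = coord i (br x (br y (e j))) - coord i (br y (br x (e j)))"
    using ij by (simp add: br_br_left coord_diff br_I e_I)
  also have "\<dots> = (\<Sum>k<n. adm x $$ (i, k) * adm y $$ (k, j)) - (\<Sum>k<n. adm y $$ (i, k) * adm x $$ (k, j))"
    using ij by (simp add: coord_br[OF br_I[OF e_I]] adm_index[symmetric])
  finally show "adm (br x y) $$ (i, j) = (adm x * adm y - adm y * adm x) $$ (i, j)"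
    using ij by (simp add: adm_index[of i j "br x y"] scalar_prod_def atLeast0LessThan)
qed simp_all

text \<open>For arguments in \<open>I\<close> this is the Killing form of \<open>I\<close>. It is
  the trace form of the action of the whole algebra on \<open>I\<close>, so that outside elements
  can be compared with elements of \<open>I\<close>.\<close>

definition kil :: "'v \<Rightarrow> 'v \<Rightarrow> 'k" where "kil x y = mtrace (adm x * adm y)"

lemma kil_alt: "kil x y = (\<Sum>i<n. \<Sum>k<n. adm x $$ (i, k) * adm y $$ (k, i))"
  unfolding kil_def by (rule mtrace_mult) simp_all

lemma kil_commute: "kil x y = kil y x"
  unfolding kil_def by (rule mtrace_comm[OF adm_carrier adm_carrier])

lemma linear_kil: "Vector_Spaces.linear scale (*) (kil x)"
proof -
  have "vector_space ((*) :: 'k \<Rightarrow> 'k \<Rightarrow> 'k)"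
    by standard (simp_all add: distrib_left distrib_right)
  moreover have "kil x (y + z) = kil x y + kil x z" for y z
    by (simp add: kil_alt adm_index_add distrib_left sum.distrib)
  moreover have "kil x (scale c y) = c * kil x y" for c y
    by (simp add: kil_alt adm_index_scale sum_distrib_left mult.left_commute)
  ultimately show ?thesis unfolding Vector_Spaces.linear_iff using vector_space_axioms by blast
qed

lemma kil_br_left: "kil (br x y) z = kil x (br y z)"
  unfolding kil_def adm_br by (rule mtrace_commutator_mult[OF adm_carrier adm_carrier adm_carrier])

lemma adm_lincomb:
  assumes "x \<in> I"
  shows "adm x = lincomb_mat n (\<lambda>m. adm (e m)) (\<lambda>m. coord m x)"
proof (rule eq_matI)
  fix i j assume ij: "i < dim_row (lincomb_mat n (\<lambda>m. adm (e m)) (\<lambda>m. coord m x))"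
    "j < dim_col (lincomb_mat n (\<lambda>m. adm (e m)) (\<lambda>m. coord m x))"
  have "adm x $$ (i, j) = adm (\<Sum>m<n. scale (coord m x) (e m)) $$ (i, j)"
    using coord_expand[OF assms] by simp
  then show "adm x $$ (i, j) = lincomb_mat n (\<lambda>m. adm (e m)) (\<lambda>m. coord m x) $$ (i, j)"
    using ij by (simp add: adm_index_sum adm_index_scale)
qed simp_all

lemma perfect_expand:
  assumes "x \<in> bracket_span I I"
  shows "\<exists>t. x = (\<Sum>i<n. \<Sum>j<n. scale (t i j) (br (e i) (e j)))"
  using assms unfolding bracket_span_def
proof (induction rule: span_induct_alt)
  case base
  show ?case by (rule exI[of _ "\<lambda>_ _. 0"]) simp
next
  case (step c z y)
  then obtain u v t where z: "z = br u v" "u \<in> I" "v \<in> I"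
    and y: "y = (\<Sum>i<n. \<Sum>j<n. scale (t i j) (br (e i) (e j)))" by blast
  have "z = br (\<Sum>i<n. scale (coord i u) (e i)) (\<Sum>j<n. scale (coord j v) (e j))"
    using z coord_expand by metis
  also have "\<dots> = (\<Sum>i<n. \<Sum>j<n. scale (coord j v * coord i u) (br (e i) (e j)))"
    unfolding br_sum_left br_scale_left br_sum_right br_scale_right
    by (simp add: scale_sum_right) (rule sum.swap)
  finally have "scale c z + y =
      (\<Sum>i<n. \<Sum>j<n. scale (c * (coord j v * coord i u) + t i j) (br (e i) (e j)))"
    by (simp add: y scale_sum_right scale_left_distrib sum.distrib)
  then show ?case by (intro exI[of _ "\<lambda>i j. c * (coord j v * coord i u) + t i j"])
qed

text \<open>Cartan's criterion is applied over the algebraic closure, where Jordan forms exist. The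
  embedding \<open>to_ac\<close> respects commutators and traces, and its injectivity brings the
  vanishing power back.\<close>

lemma perfect_killing_zero_adm_nilpotent:
  assumes perfect: "bracket_span I I = I"
    and zero: "\<And>x y. x \<in> I \<Longrightarrow> y \<in> I \<Longrightarrow> kil x y = 0" and x: "x \<in> I"
  shows "adm x ^\<^sub>m n = 0\<^sub>m n n"
proof -
  interpret ac: inj_comm_ring_hom "to_ac :: 'k \<Rightarrow> 'k alg_closure"
    by unfold_locales auto
  let ?A = "map_mat to_ac (adm x)" and ?C = "\<lambda>i. map_mat to_ac (adm (e i))"
  have hom_comm: "map_mat to_ac (adm (br u v)) =
      map_mat to_ac (adm u) * map_mat to_ac (adm v) - map_mat to_ac (adm v) * map_mat to_ac (adm u)" for u v
  proof -
    have "map_mat to_ac (adm (br u v)) = map_mat to_ac (adm u * adm v) - map_mat to_ac (adm v * adm u)"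
      unfolding adm_br by (rule eq_matI) auto
    then show ?thesis by (simp add: ac.mat_hom_mult[of _ n n _ n])
  qed
  obtain t where t: "x = (\<Sum>i<n. \<Sum>j<n. scale (t i j) (br (e i) (e j)))"
    using perfect_expand perfect x by blast
  have "?A ^\<^sub>m n = 0\<^sub>m n n"
  proof (rule traceless_structure_constants_nilpotent[where C = ?C and t = "\<lambda>i j. to_ac (t i j)"])
    fix i assume i: "i < n"
    have "?A * ?C i - ?C i * ?A = map_mat to_ac (adm (br x (e i)))"
      by (rule hom_comm[symmetric])
    also have "\<dots> = lincomb_mat n ?C (\<lambda>m. to_ac (coord m (br x (e i))))"
      unfolding adm_lincomb[OF br_I[OF e_I[OF i]]]
      by (rule eq_matI) (auto simp: ac.hom_sum)
    also have "\<dots> = lincomb_mat n ?C (\<lambda>m. ?A $$ (m, i))"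
      by (rule lincomb_mat_cong) (use i in \<open>auto simp: adm_index\<close>)
    finally show "?A * ?C i - ?C i * ?A = lincomb_mat n ?C (\<lambda>m. ?A $$ (m, i))" .
  next
    fix i j assume ij: "i < n" "j < n"
    have "mtrace (?C i * ?C j) = mtrace (map_mat to_ac (adm (e i) * adm (e j)))"
      by (simp add: ac.mat_hom_mult[of _ n n _ n])
    also have "\<dots> = to_ac (kil (e i) (e j))"
      by (simp add: mtrace_def kil_def ac.hom_sum del: index_mult_mat(1))
    also have "\<dots> = 0" using ij zero e_I by simp
    finally show "mtrace (?C i * ?C j) = 0" .
  next
    fix k l assume kl: "k < n" "l < n"
    have "adm x $$ (k, l) = (\<Sum>i<n. \<Sum>j<n. t i j * adm (br (e i) (e j)) $$ (k, l))"
      unfolding t using kl by (simp add: adm_index_sum adm_index_scale)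
    then have "?A $$ (k, l) = (\<Sum>i<n. \<Sum>j<n. to_ac (t i j) * map_mat to_ac (adm (br (e i) (e j))) $$ (k, l))"
      using kl by (simp add: ac.hom_sum)
    then show "?A $$ (k, l) = (\<Sum>i<n. \<Sum>j<n. to_ac (t i j) * (?C i * ?C j - ?C j * ?C i) $$ (k, l))"
      unfolding hom_comm .
  qed simp_all
  then have "map_mat to_ac (adm x ^\<^sub>m n) = map_mat to_ac (0\<^sub>m n n)"
    using ac.mat_hom_pow[of "adm x" n n] by auto
  then show ?thesis by (rule ac.mat_hom_inj)
qed

lemma funpow_br_lincomb:
  "(br x ^^ k) (\<Sum>i<n. scale (c i) (f i)) = (\<Sum>i<n. scale (c i) ((br x ^^ k) (f i)))"
  by (induction k) (simp_all add: br_sum_right br_scale_right)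

lemma adm_pow:
  assumes "j < n"
  shows "(br x ^^ k) (e j) = (\<Sum>i<n. scale ((adm x ^\<^sub>m k) $$ (i, j)) (e i))"
  using assms
proof (induction k arbitrary: j)
  case 0
  have "(\<Sum>i<n. scale ((1\<^sub>m n :: 'k mat) $$ (i, j)) (e i)) = (\<Sum>i<n. if i = j then e i else 0)"
    using 0 by (intro sum.cong) auto
  then show ?case using 0 by simp
next
  case (Suc k)
  have c: "adm x ^\<^sub>m k \<in> carrier_mat n n" by (rule pow_carrier_mat) simp
  have "(br x ^^ Suc k) (e j) = (br x ^^ k) (\<Sum>m<n. scale (adm x $$ (m, j)) (e m))"
    using coord_expand[OF br_I[OF e_I[OF Suc.prems]], of x] Suc.prems
    by (simp add: funpow_swap1 adm_index)
  also have "\<dots> = (\<Sum>m<n. \<Sum>i<n. scale (adm x $$ (m, j) * (adm x ^\<^sub>m k) $$ (i, m)) (e i))"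
    by (simp add: funpow_br_lincomb Suc.IH scale_sum_right)
  also have "\<dots> = (\<Sum>i<n. \<Sum>m<n. scale (adm x $$ (m, j) * (adm x ^\<^sub>m k) $$ (i, m)) (e i))"
    by (rule sum.swap)
  also have "\<dots> = (\<Sum>i<n. scale ((adm x ^\<^sub>m k * adm x) $$ (i, j)) (e i))"
    using Suc.prems c
    by (simp add: scale_sum_left[symmetric] scalar_prod_def atLeast0LessThan mult.commute)
  finally show ?case by simp
qed

lemma perfect_killing_zero_ad_nilpotent:
  assumes "bracket_span I I = I" "\<And>x y. x \<in> I \<Longrightarrow> y \<in> I \<Longrightarrow> kil x y = 0"
    and x: "x \<in> I" and v: "v \<in> I"
  shows "(br x ^^ n) v = 0"
proof -
  have "(br x ^^ n) (e j) = 0" if "j < n" for j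
    using adm_pow[OF that] perfect_killing_zero_adm_nilpotent[OF assms(1-3)] that by simp
  then have "(br x ^^ n) (\<Sum>i<n. scale (coord i v) (e i)) = 0" unfolding funpow_br_lincomb by simp
  then show ?thesis using coord_expand[OF v] by simp
qed

end

section \<open>Engel's argument\<close>

context fin_dim_lie_algebra
begin

lemma lie_subalgebra_subspace: "lie_subalgebra scale br H \<Longrightarrow> subspace H"
  unfolding lie_subalgebra_def by simp

lemma lie_subalgebra_br: "lie_subalgebra scale br H \<Longrightarrow> x \<in> H \<Longrightarrow> y \<in> H \<Longrightarrow> br x y \<in> H"
  unfolding lie_subalgebra_def by simp

lemma dim_psubset: "subspace U \<Longrightarrow> subspace V \<Longrightarrow> U \<subset> V \<Longrightarrow> dim U < dim V"
  using subspace_dim_equal[of U V] by (metis not_less psubset_eq)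

text \<open>\<open>{0}\<close> is a proper subalgebra and dimensions are bounded, so one of greatest
  dimension exists.\<close>

lemma maximal_proper_subalgebra:
  assumes H: "lie_subalgebra scale br H" "H \<noteq> {0}"
  obtains M where "lie_subalgebra scale br M" "M \<subset> H"
    "\<And>N. lie_subalgebra scale br N \<Longrightarrow> M \<subset> N \<Longrightarrow> N \<subseteq> H \<Longrightarrow> N = H"
proof -
  let ?P = "\<lambda>M. lie_subalgebra scale br M \<and> M \<subset> H"
  have P0: "?P {0}"
    using H subspace_0[OF lie_subalgebra_subspace[OF H(1)]] by (auto simp: lie_subalgebra_def)
  have bound: "\<forall>M. ?P M \<longrightarrow> dim M < Suc (dim (UNIV :: 'v set))"
    using dim_subset[OF subset_UNIV] by (simp add: less_Suc_eq_le)
  obtain M where M: "?P M" and max: "\<forall>N. ?P N \<longrightarrow> dim N \<le> dim M"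
    using ex_has_greatest_nat[OF P0 bound] by (elim exE conjE) blast
  have "N = H" if "lie_subalgebra scale br N" "M \<subset> N" "N \<subseteq> H" for N
  proof (rule ccontr)
    assume "N \<noteq> H"
    then have "dim N \<le> dim M" using max that by blast
    moreover have "dim M < dim N"
      using that M by (intro dim_psubset lie_subalgebra_subspace) auto
    ultimately show False by simp
  qed
  then show thesis using that M by blast
qed

text \<open>Since \<open>y\<close> normalizes \<open>M\<close>, adjoining it to \<open>M\<close>
  again gives a subalgebra, which by maximality is all of \<open>H\<close>.\<close>

lemma maximal_subalgebra_codim_1:
  assumes M: "lie_subalgebra scale br M" and H: "lie_subalgebra scale br H" "M \<subset> H"
    and max: "\<And>N. lie_subalgebra scale br N \<Longrightarrow> M \<subset> N \<Longrightarrow> N \<subseteq> H \<Longrightarrow> N = H"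
    and y: "y \<in> H - M" "\<And>m. m \<in> M \<Longrightarrow> br m y \<in> M" and h: "h \<in> H"
  shows "\<exists>c m. m \<in> M \<and> h = scale c y + m"
proof -
  note sM = lie_subalgebra_subspace[OF M] and sH = lie_subalgebra_subspace[OF H(1)]
  let ?N = "span (insert y M)"
  have N: "\<exists>c m. m \<in> M \<and> x = scale c y + m" if x: "x \<in> ?N" for x
  proof -
    obtain c where "x - scale c y \<in> span M" using x span_breakdown_eq[of x y M] by blast
    then have "x - scale c y \<in> M" using sM by (metis span_eq_iff)
    then show ?thesis by (intro exI[of _ c] exI[of _ "x - scale c y"]) simp
  qed
  have MN: "M \<subseteq> ?N" "y \<in> ?N" by (auto intro: span_base)
  have "br a b \<in> M" if ab: "a \<in> ?N" "b \<in> ?N" for a b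
  proof -
    obtain c m d k where a: "a = scale c y + m" "m \<in> M" and b: "b = scale d y + k" "k \<in> M"
      using N[OF ab(1)] N[OF ab(2)] by blast
    have "br a b = scale d (br m y) - scale c (br k y) + br m k"
      unfolding a b using br_commute[of y k]
      by (simp add: br_add_left br_add_right br_scale_left br_scale_right)
    then show ?thesis using a b y(2) lie_subalgebra_br[OF M]
      by (simp add: subspace_add[OF sM] subspace_diff[OF sM] subspace_scale[OF sM])
  qed
  then have "lie_subalgebra scale br ?N" using MN unfolding lie_subalgebra_def by auto
  moreover have "M \<subset> ?N" using MN y by auto
  moreover have "?N \<subseteq> H" by (rule span_minimal) (use y H sH in auto)
  ultimately have "?N = H" using max by blast
  then show ?thesis using N h by blast
qed

text \<open>Engel's theorem for the action of \<open>H\<close> on V/U, phrased with representatives: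
  some nonzero class is killed by all of \<open>H\<close>. The pair is kept general because the
  induction also uses a subalgebra \<open>M\<close> acting on H/M.\<close>

lemma engel_common_vector:
  assumes nil: "\<And>x v. x \<in> I \<Longrightarrow> v \<in> I \<Longrightarrow> \<exists>k. (br x ^^ k) v = 0"
    and "lie_subalgebra scale br H" "H \<subseteq> I" "subspace V" "subspace U" "U \<subset> V" "V \<subseteq> I"
    and "\<And>h v. h \<in> H \<Longrightarrow> v \<in> V \<Longrightarrow> br h v \<in> V" "\<And>h v. h \<in> H \<Longrightarrow> v \<in> U \<Longrightarrow> br h v \<in> U"
  shows "\<exists>v\<in>V - U. \<forall>h\<in>H. br h v \<in> U"
  using assms(2-)
proof (induction "dim H" arbitrary: H V U rule: less_induct)
  case less
  note H = less.prems(1) and HI = less.prems(2) and V = less.prems(3) and U = less.prems(4)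
    and UV = less.prems(5) and VI = less.prems(6) and HV = less.prems(7) and HU = less.prems(8)
  show ?case
  proof (cases "H = {0}")
    case True
    then show ?thesis using UV subspace_0[OF U] by auto
  next
    case False
    obtain M where M: "lie_subalgebra scale br M" "M \<subset> H"
      and max: "\<And>N. lie_subalgebra scale br N \<Longrightarrow> M \<subset> N \<Longrightarrow> N \<subseteq> H \<Longrightarrow> N = H"
      using maximal_proper_subalgebra[OF H False] by blast
    note sM = lie_subalgebra_subspace[OF M(1)] and sH = lie_subalgebra_subspace[OF H]
    have dimM: "dim M < dim H" using dim_psubset[OF sM sH M(2)] .
    have MI: "M \<subseteq> I" and MH: "\<And>m. m \<in> M \<Longrightarrow> m \<in> H" using M(2) HI by auto
    \<comment> \<open>Induction for \<open>M\<close> acting on H/M: this provides an element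
      \<open>y\<close> outside \<open>M\<close> that normalizes \<open>M\<close>.\<close>
    have "\<exists>v\<in>H - M. \<forall>h\<in>M. br h v \<in> M"
      by (rule less.hyps[OF dimM M(1) MI sH sM M(2) HI lie_subalgebra_br[OF H MH] lie_subalgebra_br[OF M(1)]])
    then obtain y where y: "y \<in> H - M" "\<And>m. m \<in> M \<Longrightarrow> br m y \<in> M" by blast
    have "\<exists>v\<in>V - U. \<forall>h\<in>M. br h v \<in> U"
      by (rule less.hyps[OF dimM M(1) MI V U UV VI HV[OF MH] HU[OF MH]])
    then obtain v0 where v0: "v0 \<in> V - U" "\<And>m. m \<in> M \<Longrightarrow> br m v0 \<in> U" by blast
    \<comment> \<open>By the Jacobi identity, and since \<open>M\<close> is normalized by
      \<open>y\<close>, the vectors that \<open>M\<close> sends into \<open>U\<close> are carried by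
      \<open>y\<close> to such vectors.\<close>
    have stable: "(br y ^^ k) v0 \<in> V \<and> (\<forall>m\<in>M. br m ((br y ^^ k) v0) \<in> U)" for k
    proof (induction k)
      case (Suc k)
      have "br m (br y ((br y ^^ k) v0)) \<in> U" if "m \<in> M" for m
        unfolding jacobi[of m y] using Suc y that HU[of y] by (auto intro!: subspace_add[OF U])
      then show ?case using Suc y HV by auto
    qed (use v0 in auto)
    have "\<exists>k. (br y ^^ k) v0 \<in> U"
      using nil[of y v0] y v0 HI VI subspace_0[OF U] by (metis DiffE subsetD)
    \<comment> \<open>As \<open>y\<close> acts nilpotently, some iterate is the first to fall into
      \<open>U\<close>; the one before it is the required vector.\<close>
    then obtain k where k: "(br y ^^ k) v0 \<in> U" "\<And>j. j < k \<Longrightarrow> (br y ^^ j) v0 \<notin> U"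
      using exists_least_iff[of "\<lambda>k. (br y ^^ k) v0 \<in> U"] by blast
    then obtain j where j: "k = Suc j" using v0 by (cases k) auto
    let ?v = "(br y ^^ j) v0"
    have "br h ?v \<in> U" if "h \<in> H" for h
    proof -
      have "\<exists>c m. m \<in> M \<and> h = scale c y + m"
        by (rule maximal_subalgebra_codim_1[OF M(1) H M(2)]) (use max y that in auto)
      then show ?thesis using stable[of j] k(1) j
        by (auto simp: br_add_left br_scale_left intro!: subspace_add[OF U] subspace_scale[OF U])
    qed
    then show ?thesis using stable[of j] k(2)[of j] j by auto
  qed
qed

text \<open>Otherwise a maximal proper subalgebra \<open>M\<close> is normalized by some
  \<open>y\<close> outside it and so has codimension one; then all brackets fall into
  \<open>M\<close>.\<close>

lemma perfect_ad_nilpotent_trivial: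
  assumes nil: "\<And>x v. x \<in> I \<Longrightarrow> v \<in> I \<Longrightarrow> \<exists>k. (br x ^^ k) v = 0"
    and I: "lie_subalgebra scale br I" and perfect: "bracket_span I I = I"
  shows "I = {0}"
proof (rule ccontr)
  assume "I \<noteq> {0}"
  then obtain M where M: "lie_subalgebra scale br M" "M \<subset> I"
    and max: "\<And>N. lie_subalgebra scale br N \<Longrightarrow> M \<subset> N \<Longrightarrow> N \<subseteq> I \<Longrightarrow> N = I"
    using maximal_proper_subalgebra[OF I] by blast
  note sM = lie_subalgebra_subspace[OF M(1)] and sI = lie_subalgebra_subspace[OF I]
  have MI: "M \<subseteq> I" and MI': "\<And>m. m \<in> M \<Longrightarrow> m \<in> I" using M(2) by auto
  have "\<exists>v\<in>I - M. \<forall>h\<in>M. br h v \<in> M"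
    by (rule engel_common_vector[OF nil M(1) MI sI sM M(2) order_refl lie_subalgebra_br[OF I MI'] lie_subalgebra_br[OF M(1)]])
  then obtain y where y: "y \<in> I - M" "\<And>m. m \<in> M \<Longrightarrow> br m y \<in> M" by blast
  have codim: "\<exists>c m. m \<in> M \<and> h = scale c y + m" if "h \<in> I" for h
    by (rule maximal_subalgebra_codim_1[OF M(1) I M(2)]) (use max y that in auto)
  have "br a b \<in> M" if ab: "a \<in> I" "b \<in> I" for a b
  proof -
    obtain c m d k where a: "a = scale c y + m" "m \<in> M" and b: "b = scale d y + k" "k \<in> M"
      using codim ab by meson
    have "br a b = scale d (br m y) - scale c (br k y) + br m k"
      unfolding a b using br_commute[of y k]
      by (simp add: br_add_left br_add_right br_scale_left br_scale_right)
    then show ?thesis using a b y(2) lie_subalgebra_br[OF M(1)]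
      by (simp add: subspace_add[OF sM] subspace_diff[OF sM] subspace_scale[OF sM])
  qed
  then have "bracket_span I I \<subseteq> M" by (intro bracket_span_subset[OF sM])
  then show False using perfect M(2) by auto
qed

end

section \<open>The orthogonal of the radical\<close>

context fin_dim_lie_algebra
begin

text \<open>Induction on the set of functionals: either \<open>h a\<close> vanishes on the common
  kernel of the others and is redundant, or subtracting a multiple of it from \<open>g\<close>
  reduces to the smaller set.\<close>

lemma functional_in_span:
  fixes h :: "'b \<Rightarrow> 'v \<Rightarrow> 'k"
  assumes "finite A" and V: "subspace V"
    and "\<And>a. a \<in> A \<Longrightarrow> Vector_Spaces.linear scale (*) (h a)"
    and "Vector_Spaces.linear scale (*) g"
    and "\<And>x. x \<in> V \<Longrightarrow> \<forall>a\<in>A. h a x = 0 \<Longrightarrow> g x = 0"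
  shows "\<exists>c. \<forall>x\<in>V. g x = (\<Sum>a\<in>A. c a * h a x)"
  using assms(1,3-)
proof (induction A arbitrary: g)
  case empty
  then show ?case by simp
next
  case (insert a A)
  interpret g: Vector_Spaces.linear scale "(*)" g by fact
  interpret ha: Vector_Spaces.linear scale "(*)" "h a" using insert by simp
  show ?case
  proof (cases "\<exists>x0\<in>V. (\<forall>b\<in>A. h b x0 = 0) \<and> h a x0 \<noteq> 0")
    case False
    then have "\<exists>c. \<forall>x\<in>V. g x = (\<Sum>b\<in>A. c b * h b x)"
      using insert.prems by (intro insert.IH) auto
    then obtain c where "\<forall>x\<in>V. g x = (\<Sum>b\<in>A. c b * h b x)" by blast
    then show ?thesis using insert.hyps
      by (intro exI[of _ "c(a := 0)"]) (auto intro!: sum.cong)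
  next
    case True
    then obtain x0 where x0: "x0 \<in> V" "\<And>b. b \<in> A \<Longrightarrow> h b x0 = 0" "h a x0 \<noteq> 0" by blast
    define r where "r = g x0 / h a x0"
    have lin: "Vector_Spaces.linear scale (*) (\<lambda>x. g x - r * h a x)"
      using g.linear_axioms unfolding Vector_Spaces.linear_iff
      by (simp add: ha.add ha.scale distrib_left right_diff_distrib mult.left_commute)
    have "\<exists>c. \<forall>x\<in>V. g x - r * h a x = (\<Sum>b\<in>A. c b * h b x)"
    proof (rule insert.IH[OF _ lin])
      fix x assume x: "x \<in> V" "\<forall>b\<in>A. h b x = 0"
      \<comment> \<open>Shifting \<open>x\<close> along \<open>x0\<close> makes \<open>h a\<close>
        vanish without disturbing the other functionals, so the hypothesis on \<open>g\<close>
        applies to \<open>y\<close>.\<close>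
      define y where "y = x - scale (h a x / h a x0) x0"
      have "y \<in> V" unfolding y_def by (intro subspace_diff subspace_scale V x x0)
      moreover have "h b y = 0" if b: "b \<in> insert a A" for b
      proof -
        interpret hb: Vector_Spaces.linear scale "(*)" "h b" using insert.prems(1) b by simp
        show ?thesis using x x0 b by (auto simp: y_def hb.diff hb.scale)
      qed
      ultimately have "g y = 0" using insert.prems(3) by blast
      then show "g x - r * h a x = 0" using x0(3) by (simp add: y_def g.diff g.scale r_def field_simps)
    qed (use insert.prems in auto)
    then obtain c where "\<forall>x\<in>V. g x - r * h a x = (\<Sum>b\<in>A. c b * h b x)" by blast
    then have c: "\<forall>x\<in>V. g x = r * h a x + (\<Sum>b\<in>A. c b * h b x)" by (metis add.commute diff_add_cancel)
    have "(\<Sum>b\<in>A. (c(a := r)) b * h b x) = (\<Sum>b\<in>A. c b * h b x)" for x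
      using insert.hyps by (intro sum.cong) auto
    then show ?thesis using c insert.hyps by (intro exI[of _ "c(a := r)"]) simp
  qed
qed

text \<open>The functionals \<open>K a\<close> for \<open>a\<close> in a basis of \<open>V\<close>
  span \<open>g\<close>, and the coefficients assemble to \<open>u\<close>. The form may be
  degenerate on \<open>V\<close> as long as \<open>g\<close> vanishes on its radical; this covers
  the trace form on an ideal as well as \<open>phi\<close>.\<close>

lemma functional_representable:
  assumes V: "subspace V"
    and linK: "\<And>x. Vector_Spaces.linear scale (*) (K x)" and sym: "\<And>x y. K x y = K y x"
    and g: "Vector_Spaces.linear scale (*) g"
    and ker: "\<And>x. x \<in> V \<Longrightarrow> \<forall>y\<in>V. K y x = 0 \<Longrightarrow> g x = 0"
  shows "\<exists>u\<in>V. \<forall>x\<in>V. g x = K u x"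
proof -
  obtain A where A: "A \<subseteq> V" "independent A" "V \<subseteq> span A" using basis_exists[of V] by metis
  have "finite A" using A(2) by (rule finiteI_independent)
  have "\<exists>c. \<forall>x\<in>V. g x = (\<Sum>a\<in>A. c a * K a x)"
  proof (rule functional_in_span[OF \<open>finite A\<close> V linK g])
    fix x assume x: "x \<in> V" "\<forall>a\<in>A. K a x = 0"
    interpret Kx: Vector_Spaces.linear scale "(*)" "K x" by (rule linK)
    have "\<forall>a\<in>A. K x a = 0" using x(2) sym by metis
    then have "span A \<subseteq> {y. K x y = 0}"
      by (intro span_minimal) (auto simp: subspace_def Kx.zero Kx.add Kx.scale)
    then have "K y x = 0" if "y \<in> V" for y using that A(3) sym[of y x] by auto
    then show "g x = 0" using ker x(1) by blast
  qed
  then obtain c where c: "\<forall>x\<in>V. g x = (\<Sum>a\<in>A. c a * K a x)" by blast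
  have "K (\<Sum>a\<in>A. scale (c a) a) x = (\<Sum>a\<in>A. c a * K a x)" for x
  proof -
    interpret Kx: Vector_Spaces.linear scale "(*)" "K x" by (rule linK)
    show ?thesis unfolding sym[of _ x] by (simp add: Kx.sum Kx.scale)
  qed
  moreover have "(\<Sum>a\<in>A. scale (c a) a) \<in> V"
    using A(1) by (intro subspace_sum V subspace_scale) auto
  ultimately show ?thesis using c by metis
qed

lemma lie_ideal_subspace: "lie_ideal scale br I \<Longrightarrow> subspace I"
  unfolding lie_ideal_def by simp

lemma lie_ideal_br: "lie_ideal scale br I \<Longrightarrow> y \<in> I \<Longrightarrow> br x y \<in> I"
  unfolding lie_ideal_def by simp

lemma lie_ideal_br_left:
  assumes "lie_ideal scale br I" "y \<in> I" shows "br y x \<in> I"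
  using lie_ideal_br[OF assms, of x] subspace_neg[OF lie_ideal_subspace[OF assms(1)]] br_commute[of y x] by simp

lemma lie_ideal_bracket_span:
  assumes I: "lie_ideal scale br I"
  shows "lie_ideal scale br (bracket_span I I)"
proof -
  have "br x z \<in> bracket_span I I" if "z \<in> bracket_span I I" for x z
  proof -
    have "bracket_span I I \<subseteq> {z. br x z \<in> bracket_span I I}"
    proof (rule bracket_span_subset)
      show "subspace {z. br x z \<in> bracket_span I I}"
        using subspace_bracket_span[of I I] by (auto simp: subspace_def br_add_right br_scale_right)
      fix a b assume "a \<in> I" "b \<in> I"
      then show "br a b \<in> {z. br x z \<in> bracket_span I I}"
        using lie_ideal_br[OF I]
        by (simp add: jacobi[of x a] br_in_bracket_span subspace_add[OF subspace_bracket_span])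
    qed
    then show ?thesis using that by blast
  qed
  then show ?thesis unfolding lie_ideal_def using subspace_bracket_span by blast
qed

lemma derived_series_Suc: "derived_series scale br I (Suc m) =
    bracket_span (derived_series scale br I m) (derived_series scale br I m)"
  by (simp add: bracket_span_def)

text \<open>The derived series of \<open>I\<close>, shifted by one, stays inside that of
  \<open>J\<close>.\<close>

lemma solvable_if_derived_subset:
  assumes "bracket_span I I \<subseteq> J" and J: "solvable scale br J"
  shows "solvable scale br I"
proof -
  obtain m where m: "derived_series scale br J m = {0}" using J unfolding solvable_def by blast
  have "derived_series scale br I (Suc k) \<subseteq> derived_series scale br J k" for k
  proof (induction k)
    case 0
    then show ?case using assms(1) by (simp add: bracket_span_def)
  next
    case (Suc k)
    show ?case
      unfolding derived_series_Suc[of I "Suc k"]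
      unfolding derived_series_Suc[of J k]
      by (rule bracket_span_subset[OF subspace_bracket_span]) (use Suc in \<open>blast intro: br_in_bracket_span\<close>)
  qed
  from this[of m] have "derived_series scale br I (Suc m) = {0}"
    using m subspace_0[OF subspace_bracket_span] unfolding derived_series_Suc by blast
  then show ?thesis unfolding solvable_def by blast
qed

lemma obtain_ideal_basis:
  assumes "lie_ideal scale br I"
  obtains n e where "lie_ideal_basis scale br I n e"
proof -
  note sI = lie_ideal_subspace[OF assms]
  obtain B where B: "B \<subseteq> I" "independent B" "I \<subseteq> span B" using basis_exists[of I] by metis
  have "finite B" using B(2) by (rule finiteI_independent)
  then obtain e where e: "bij_betw e {..<card B} B"
    using ex_bij_betw_nat_finite[of B] by (auto simp: atLeast0LessThan)
  have "span B = I" using B span_minimal[OF B(1) sI] by auto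
  then have "lie_ideal_basis scale br I (card B) e"
    by unfold_locales (use assms B e in \<open>auto simp: bij_betw_def\<close>)
  then show thesis by (rule that)
qed

end

section \<open>Invariant forms and orthogonal ideals\<close>

locale fin_dim_quadratic_lie_algebra = fin_dim_lie_algebra scale br
  for scale :: "'k::field_char_0 \<Rightarrow> 'v::ab_group_add \<Rightarrow> 'v" and br :: "'v \<Rightarrow> 'v \<Rightarrow> 'v" +
  fixes phi :: "'v \<Rightarrow> 'v \<Rightarrow> 'k"
  assumes quad: "quadratic_lie_algebra scale br phi"
begin

lemma linear_phi: "Vector_Spaces.linear scale (*) (phi x)"
  and phi_commute: "phi x y = phi y x"
  and phi_nondegenerate: "(\<And>y. phi x y = 0) \<Longrightarrow> x = 0"
  and phi_invariant: "phi (br x y) z = - phi y (br x z)"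
proof -
  show "Vector_Spaces.linear scale (*) (phi x)" "phi x y = phi y x"
    using quad unfolding quadratic_lie_algebra_def by blast+
  show "x = 0" if "\<And>y. phi x y = 0"
    using quad that unfolding quadratic_lie_algebra_def by blast
  have "phi (br x y) z + phi y (br x z) = 0"
    using quad unfolding quadratic_lie_algebra_def by blast
  then show "phi (br x y) z = - phi y (br x z)" by (simp only: eq_neg_iff_add_eq_0)
qed

lemma phi_add_right: "phi x (y + z) = phi x y + phi x z"
  and phi_scale_right: "phi x (scale c y) = c * phi x y"
  and phi_diff_right: "phi x (y - z) = phi x y - phi x z"
  and phi_zero_right [simp]: "phi x 0 = 0"
proof -
  interpret L: Vector_Spaces.linear scale "(*)" "phi x" by (rule linear_phi)
  show "phi x (y + z) = phi x y + phi x z" "phi x (scale c y) = c * phi x y"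
    "phi x (y - z) = phi x y - phi x z" "phi x 0 = 0"
    by (fact L.add L.scale L.diff L.zero)+
qed

lemma phi_add_left: "phi (x + y) z = phi x z + phi y z"
  and phi_scale_left: "phi (scale c x) z = c * phi x z"
  and phi_diff_left: "phi (x - y) z = phi x z - phi y z"
  and phi_zero_left [simp]: "phi 0 z = 0"
proof -
  show "phi (x + y) z = phi x z + phi y z" "phi (scale c x) z = c * phi x z"
    "phi (x - y) z = phi x z - phi y z" "phi 0 z = 0"
    unfolding phi_commute[of _ z] by (simp_all add: phi_add_right phi_scale_right phi_diff_right)
qed

lemma lie_ideal_orth:
  assumes "lie_ideal scale br R"
  shows "lie_ideal scale br (orth phi R)"
proof -
  have "br x y \<in> orth phi R" if "y \<in> orth phi R" for x y
    using that lie_ideal_br[OF assms] unfolding orth_def by (simp add: phi_invariant)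
  moreover have "subspace (orth phi R)"
    unfolding subspace_def orth_def by (simp add: phi_add_left phi_scale_left)
  ultimately show ?thesis unfolding lie_ideal_def by blast
qed

text \<open>Invariance moves \<open>r\<close> onto \<open>z\<close>, and the bracket of
  \<open>r\<close> and \<open>z\<close> lies in the ideal \<open>R\<close>, to which
  \<open>w\<close> is orthogonal.\<close>

lemma br_ideal_orth:
  assumes "lie_ideal scale br R" "r \<in> R" "w \<in> orth phi R"
  shows "br r w = 0"
proof (rule phi_nondegenerate)
  fix z
  show "phi (br r w) z = 0"
    using assms lie_ideal_br_left[OF assms(1,2)] by (simp add: phi_invariant orth_def)
qed

lemma orth_radical_subset:
  assumes no_simple: "\<nexists>I. simple_ideal scale br I" and rad: "is_solvable_radical scale br R"
  shows "orth phi R \<subseteq> R"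
proof (rule ccontr)
  assume nsub: "\<not> orth phi R \<subseteq> R"
  have R: "lie_ideal scale br R" "solvable scale br R"
    and Rmax: "\<And>I. lie_ideal scale br I \<Longrightarrow> solvable scale br I \<Longrightarrow> I \<subseteq> R"
    using rad unfolding is_solvable_radical_def by auto
  let ?W = "orth phi R"
  let ?P = "\<lambda>I. lie_ideal scale br I \<and> I \<subseteq> ?W \<and> \<not> I \<subseteq> R"
  have "?P ?W" using lie_ideal_orth[OF R(1)] nsub by simp
  then have "\<exists>I. ?P I \<and> (\<forall>J. ?P J \<longrightarrow> dim I \<le> dim J)" by (rule ex_has_least_nat)
  then obtain I where I: "lie_ideal scale br I" "I \<subseteq> ?W" "\<not> I \<subseteq> R"
    and least: "\<And>J. ?P J \<Longrightarrow> dim I \<le> dim J" by blast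
  note sI = lie_ideal_subspace[OF I(1)]
  \<comment> \<open>Minimality concerns only ideals not inside \<open>R\<close>; nonzero ideals
    inside both \<open>I\<close> and \<open>R\<close> are excluded later by
    \<open>IR\<close>.\<close>
  have minimal: "J = I" if "lie_ideal scale br J" "J \<subseteq> I" "\<not> J \<subseteq> R" for J
    using subspace_dim_equal[OF lie_ideal_subspace[OF that(1)] sI that(2)] least[of J] that I(2) by auto
  have perfect: "bracket_span I I = I"
  proof (rule minimal)
    show "lie_ideal scale br (bracket_span I I)" by (rule lie_ideal_bracket_span[OF I(1)])
    show "bracket_span I I \<subseteq> I" by (rule bracket_span_subset[OF sI]) (rule lie_ideal_br[OF I(1)])
    \<comment> \<open>A derived ideal inside the solvable \<open>R\<close> would make
      \<open>I\<close> solvable, hence contained in \<open>R\<close>.\<close>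
    show "\<not> bracket_span I I \<subseteq> R"
      using solvable_if_derived_subset[OF _ R(2)] Rmax[OF I(1)] I(3) by blast
  qed
  obtain n e where "lie_ideal_basis scale br I n e" using obtain_ideal_basis[OF I(1)] .
  then interpret B: lie_ideal_basis scale br I n e .
  have br_RI: "br r y = 0" "br y r = 0" if "r \<in> R" "y \<in> I" for r y
  proof -
    show *: "br r y = 0" using br_ideal_orth[OF R(1) that(1)] that(2) I(2) by blast
    show "br y r = 0" using br_commute[of y r] * by simp
  qed
  have kil_R: "B.kil x z = 0" if "z \<in> R" for x z
  proof -
    have "B.adm z $$ (i, j) = 0" if "i < n" "j < n" for i j
      using that br_RI(1)[OF \<open>z \<in> R\<close> B.e_I] by (simp add: B.adm_index)
    then show ?thesis by (simp add: B.kil_alt)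
  qed
  have kil_add: "B.kil x (y + z) = B.kil x y + B.kil x z" and kil_scale: "B.kil x (scale c y) = c * B.kil x y"
    and kil_diff: "B.kil x (y - z) = B.kil x y - B.kil x z" and kil_0: "B.kil x 0 = 0" for x y z c
  proof -
    interpret L: Vector_Spaces.linear scale "(*)" "B.kil x" by (rule B.linear_kil)
    show "B.kil x (y + z) = B.kil x y + B.kil x z" "B.kil x (scale c y) = c * B.kil x y"
      "B.kil x (y - z) = B.kil x y - B.kil x z" "B.kil x 0 = 0" by (fact L.add L.scale L.diff L.zero)+
  qed
  define N where "N = {x \<in> I. \<forall>y\<in>I. B.kil y x = 0}"
  have "lie_ideal scale br N"
  proof -
    have "B.kil y (br l x) = 0" if "x \<in> N" "y \<in> I" for y l x
      using that lie_ideal_br_left[OF I(1) that(2), of l] by (simp add: N_def flip: B.kil_br_left)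
    then show ?thesis using sI lie_ideal_br[OF I(1)]
      by (auto simp: lie_ideal_def subspace_def N_def kil_add kil_scale kil_0)
  qed
  moreover have "N \<noteq> I"
  proof
    assume "N = I"
    then have zero: "B.kil x y = 0" if "x \<in> I" "y \<in> I" for x y using that by (auto simp: N_def)
    have "I = {0}"
    proof (rule perfect_ad_nilpotent_trivial[OF _ _ perfect])
      show "\<exists>k. (br x ^^ k) v = 0" if "x \<in> I" "v \<in> I" for x v
        using B.perfect_killing_zero_ad_nilpotent[OF perfect zero that] by blast
      show "lie_subalgebra scale br I"
        using sI lie_ideal_br[OF I(1)] by (simp add: lie_subalgebra_def)
    qed
    then show False using I(3) subspace_0[OF lie_ideal_subspace[OF R(1)]] by simp
  qed
  ultimately have NR: "N \<subseteq> R" using minimal[of N] by (auto simp: N_def)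
  \<comment> \<open>Every \<open>l\<close> acts on \<open>I\<close> like some \<open>u\<close> in
    \<open>I\<close>: the functional \<open>B.kil l\<close> vanishes on \<open>N\<close>, because
    \<open>N\<close> lies in \<open>R\<close> and \<open>R\<close> acts as zero on \<open>I\<close>,
    so it is represented by an element of \<open>I\<close>.\<close>
  have split: "\<exists>u\<in>I. \<forall>y\<in>I. br (l - u) y = 0" for l
  proof -
    have "\<exists>u\<in>I. \<forall>y\<in>I. B.kil l y = B.kil u y"
    proof (rule functional_representable[OF sI B.linear_kil B.kil_commute B.linear_kil])
      fix x assume "x \<in> I" "\<forall>y\<in>I. B.kil y x = 0"
      then have "x \<in> R" using NR by (auto simp: N_def)
      then show "B.kil l x = 0" by (rule kil_R)
    qed
    then obtain u where u: "u \<in> I" "\<And>y. y \<in> I \<Longrightarrow> B.kil l y = B.kil u y" by blast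
    let ?p = "l - u"
    have kil_p: "B.kil ?p y = 0" if "y \<in> I" for y
      using u(2)[OF that] unfolding B.kil_commute[of _ y] by (simp add: kil_diff)
    have pN: "br ?p y \<in> R" if y: "y \<in> I" for y
    proof -
      have "B.kil z (br ?p y) = 0" if "z \<in> I" for z
        using kil_p[OF lie_ideal_br[OF I(1) that, of y]]
        by (simp add: B.kil_commute[of z] B.kil_br_left)
      then show ?thesis using NR lie_ideal_br[OF I(1) y] by (auto simp: N_def)
    qed
    \<comment> \<open>By the Jacobi identity \<open>?p\<close> sends a bracket in \<open>I\<close>
      to brackets between \<open>R\<close> and \<open>I\<close>, which vanish; and brackets span
      \<open>I\<close>.\<close>
    have "bracket_span I I \<subseteq> {z. br ?p z = 0}"
      by (rule bracket_span_subset)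
        (auto simp: subspace_def br_add_right br_scale_right jacobi[of ?p] br_RI pN)
    then show ?thesis using u(1) perfect by blast
  qed
  have IR: "z = 0" if z: "z \<in> I" "z \<in> R" for z
  proof (rule phi_nondegenerate)
    fix l
    obtain u where u: "u \<in> I" "\<And>y. y \<in> I \<Longrightarrow> br (l - u) y = 0" using split[of l] by blast
    \<comment> \<open>\<open>l - u\<close> centralizes \<open>I\<close>, so by invariance it is
      orthogonal to all brackets and thus to \<open>I\<close>. The other part \<open>u\<close> lies
      in \<open>?W\<close> and is orthogonal to \<open>z\<close>, which lies in
      \<open>R\<close>.\<close>
    have "bracket_span I I \<subseteq> {z. phi z (l - u) = 0}"
    proof (rule bracket_span_subset)
      show "subspace {z. phi z (l - u) = 0}" by (auto simp: subspace_def phi_add_left phi_scale_left)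
      fix a b assume "a \<in> I" "b \<in> I"
      then show "br a b \<in> {z. phi z (l - u) = 0}"
        using u(2)[of a] br_commute[of a "l - u"] by (simp add: phi_invariant)
    qed
    then have "phi z (l - u) = 0" using perfect z by blast
    moreover have "phi z u = 0" using u(1) z I(2) by (auto simp: orth_def phi_commute[of z])
    ultimately show "phi z l = 0" by (simp add: phi_diff_right)
  qed
  have "simple_ideal scale br I"
    unfolding simple_ideal_def
  proof (intro conjI allI impI)
    show "lie_ideal scale br I" by (rule I(1))
    show "\<exists>x\<in>I. \<exists>y\<in>I. br x y \<noteq> 0"
    proof (rule ccontr)
      assume "\<not> ?thesis"
      then have "bracket_span I I \<subseteq> {0}" by (intro bracket_span_subset) auto
      then show False using perfect I(3) subspace_0[OF lie_ideal_subspace[OF R(1)]] by blast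
    qed
    fix J assume J: "subspace J \<and> J \<subseteq> I \<and> (\<forall>x\<in>I. \<forall>y\<in>J. br x y \<in> J)"
    \<comment> \<open>\<open>J\<close> is only assumed stable under \<open>I\<close>, but
      \<open>l\<close> acts on \<open>I\<close> like \<open>u\<close>, so \<open>J\<close> is an
      ideal of the whole algebra.\<close>
    have "br l y \<in> J" if "y \<in> J" for l y
    proof -
      obtain u where u: "u \<in> I" "\<And>y. y \<in> I \<Longrightarrow> br (l - u) y = 0" using split[of l] by blast
      have "br l y = br u y" using u(2)[of y] J that by (auto simp: br_diff_left)
      then show ?thesis using J u(1) that by auto
    qed
    then have "lie_ideal scale br J" using J by (simp add: lie_ideal_def)
    then show "J = {0} \<or> J = I"
      using minimal[of J] J IR subspace_0[of J] by blast
  qed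
  then show False using no_simple by blast
qed

end

section \<open>The double extension\<close>

context fin_dim_lie_algebra
begin

lemma mem_qclass: "z \<in> qclass U x \<longleftrightarrow> z - x \<in> U"
  unfolding qclass_def by (auto simp: image_iff algebra_simps intro!: bexI[of _ "z - x"])

lemma qclass_eq_iff:
  assumes "subspace U"
  shows "qclass U x = qclass U y \<longleftrightarrow> x - y \<in> U"
proof
  assume "qclass U x = qclass U y"
  then have "x \<in> qclass U y" using mem_qclass[of x U x] subspace_0[OF assms] by simp
  then show "x - y \<in> U" by (simp add: mem_qclass)
next
  assume *: "x - y \<in> U"
  have "z - x \<in> U \<longleftrightarrow> z - y \<in> U" for z
    using subspace_add[OF assms, of "z - x" "x - y"] subspace_diff[OF assms, of "z - y" "x - y"] * by auto
  then show "qclass U x = qclass U y" by (auto simp: mem_qclass)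
qed

lemma qadd_qclass:
  assumes "subspace U"
  shows "qadd (qclass U x) (qclass U y) = qclass U (x + y)"
proof (intro equalityI subsetI)
  fix z assume "z \<in> qadd (qclass U x) (qclass U y)"
  then obtain a b where "z = a + b" "a - x \<in> U" "b - y \<in> U" unfolding qadd_def by (auto simp: mem_qclass)
  then show "z \<in> qclass U (x + y)"
    using subspace_add[OF assms, of "a - x" "b - y"] by (simp add: mem_qclass algebra_simps)
next
  fix z assume z: "z \<in> qclass U (x + y)"
  have "z = (z - y) + y" by simp
  moreover have "z - y \<in> qclass U x" "y \<in> qclass U y"
    using z subspace_0[OF assms] by (simp_all add: mem_qclass algebra_simps)
  ultimately show "z \<in> qadd (qclass U x) (qclass U y)" unfolding qadd_def by blast
qed

lemma qscale_qclass:
  assumes "subspace U"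
  shows "qscale scale U c (qclass U x) = qclass U (scale c x)"
proof (intro equalityI subsetI)
  fix z assume "z \<in> qscale scale U c (qclass U x)"
  then obtain a w where "z = scale c a + w" "a - x \<in> U" "w \<in> U" unfolding qscale_def by (auto simp: mem_qclass)
  then show "z \<in> qclass U (scale c x)"
    using subspace_add[OF assms subspace_scale[OF assms, of "a - x" c], of w]
    by (simp add: mem_qclass algebra_simps)
next
  fix z assume "z \<in> qclass U (scale c x)"
  then have "z = scale c x + (z - scale c x)" "z - scale c x \<in> U" by (simp_all add: mem_qclass)
  moreover have "x \<in> qclass U x" using subspace_0[OF assms] by (simp add: mem_qclass)
  ultimately show "z \<in> qscale scale U c (qclass U x)" unfolding qscale_def by blast
qed

lemma qneg_qclass:
  assumes "subspace U"
  shows "qneg scale U (qclass U x) = qclass U (- x)"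
  unfolding qneg_def qscale_qclass[OF assms] by simp

lemma PhiS_qclass:
  assumes U: "lie_ideal scale br U"
  shows "PhiS br U a (qclass U x) = qclass U (br a x)"
proof (intro equalityI subsetI)
  note sU = lie_ideal_subspace[OF U]
  fix z assume "z \<in> PhiS br U a (qclass U x)"
  then obtain y w where "z = br a y + w" "y - x \<in> U" "w \<in> U" unfolding PhiS_def by (auto simp: mem_qclass)
  then show "z \<in> qclass U (br a x)"
    using subspace_add[OF sU lie_ideal_br[OF U, of "y - x" a], of w]
    by (simp add: mem_qclass br_diff_right algebra_simps)
next
  fix z assume "z \<in> qclass U (br a x)"
  then have "z = br a x + (z - br a x)" "z - br a x \<in> U" by (simp_all add: mem_qclass)
  moreover have "x \<in> qclass U x"
    using subspace_0[OF lie_ideal_subspace[OF U]] by (simp add: mem_qclass)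
  ultimately show "z \<in> PhiS br U a (qclass U x)" unfolding PhiS_def by blast
qed

lemma qbr_qclass:
  assumes U: "lie_ideal scale br U"
  shows "qbr br U (qclass U x) (qclass U y) = qclass U (br x y)"
proof (intro equalityI subsetI)
  note sU = lie_ideal_subspace[OF U]
  fix z assume "z \<in> qbr br U (qclass U x) (qclass U y)"
  then obtain a b w where z: "z = br a b + w" "a - x \<in> U" "b - y \<in> U" "w \<in> U"
    unfolding qbr_def by (auto simp: mem_qclass)
  have "z - br x y = br (a - x) b + br x (b - y) + w"
    unfolding z by (simp add: br_diff_left br_diff_right)
  moreover have "\<dots> \<in> U"
    using z by (intro subspace_add[OF sU] lie_ideal_br[OF U] lie_ideal_br_left[OF U])
  ultimately show "z \<in> qclass U (br x y)" unfolding mem_qclass by simp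
next
  fix z assume "z \<in> qclass U (br x y)"
  then have "z = br x y + (z - br x y)" "z - br x y \<in> U" by (simp_all add: mem_qclass)
  moreover have "x \<in> qclass U x" "y \<in> qclass U y"
    using subspace_0[OF lie_ideal_subspace[OF U]] by (simp_all add: mem_qclass)
  ultimately show "z \<in> qbr br U (qclass U x) (qclass U y)" unfolding qbr_def by blast
qed

end

section \<open>The form on the quotient and the explicit isomorphism\<close>

context fin_dim_quadratic_lie_algebra
begin

text \<open>The choice made by \<open>SOME\<close> is harmless: changes of representative lie in
  \<open>orth phi R\<close> and are paired with elements of \<open>R\<close>. That the chosen
  \<open>b\<close> lies in \<open>R\<close> uses \<open>sub\<close>.\<close>

lemma qform_qclass:
  assumes R: "lie_ideal scale br R" and sub: "orth phi R \<subseteq> R" and x: "x \<in> R" and y: "y \<in> R"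
  shows "qform phi (qclass (orth phi R) x) (qclass (orth phi R) y) = phi x y"
proof -
  let ?W = "orth phi R"
  note sW = lie_ideal_subspace[OF lie_ideal_orth[OF R]] and sR = lie_ideal_subspace[OF R]
  define a where "a = (SOME a. a \<in> qclass ?W x)"
  define b where "b = (SOME b. b \<in> qclass ?W y)"
  have "x \<in> qclass ?W x" "y \<in> qclass ?W y" using subspace_0[OF sW] by (simp_all add: mem_qclass)
  then have "a \<in> qclass ?W x" "b \<in> qclass ?W y" unfolding a_def b_def by (auto intro: someI)
  then have ab: "a - x \<in> ?W" "b - y \<in> ?W" by (simp_all add: mem_qclass)
  then have "b \<in> R" using subspace_add[OF sR _ y, of "b - y"] sub by auto
  then have "phi (a - x) b = 0" "phi (b - y) x = 0" using ab x by (simp_all add: orth_def)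
  then have "phi a b = phi x y"
    using phi_commute[of b x] phi_commute[of y x] by (simp add: phi_diff_left)
  then show ?thesis unfolding qform_def a_def b_def .
qed

text \<open>One map serves both claims of the theorem: without the last conjunct it is the Lie
  isomorphism, with it the isometry.\<close>

lemma double_extension_isomorphism:
  assumes R: "lie_ideal scale br R" and sub: "orth phi R \<subseteq> R" and levi: "is_levi_factor scale br R S"
  defines "W \<equiv> orth phi R"
  shows "\<exists>f. bij_betw f UNIV (dext_carrier scale S (quotient_space R W)) \<and>
    (\<forall>x y. f (x + y) = dext_add qadd (f x) (f y)) \<and>
    (\<forall>c x. f (scale c x) = dext_scale scale (qscale scale W) c (f x)) \<and>
    (\<forall>x y. f (br x y) = dext_br S br qadd (qneg scale W) (qbr br W) (qform phi) (PhiS br W) (f x) (f y)) \<and>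
    (\<forall>x y. dext_form (qform phi) (f x) (f y) + S_part_form phi (f x) (f y) = phi x y)"
proof -
  have W: "lie_ideal scale br W" unfolding W_def by (rule lie_ideal_orth[OF R])
  note sR = lie_ideal_subspace[OF R] and sW = lie_ideal_subspace[OF W]
  have S: "lie_subalgebra scale br S" and SR: "S \<inter> R = {0}" and L: "\<And>x. \<exists>s\<in>S. \<exists>r\<in>R. x = s + r"
    using levi unfolding is_levi_factor_def by auto
  note sS = lie_subalgebra_subspace[OF S]
  have "\<forall>x. \<exists>s. s \<in> S \<and> x - s \<in> R" using L by (metis add_diff_cancel_left')
  \<comment> \<open>\<open>p\<close> is the projection onto \<open>S\<close> along \<open>R\<close>.
    Uniqueness of the decomposition makes it linear, and the ideal property of \<open>R\<close>
    makes it a Lie homomorphism.\<close>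
  then obtain p where pS: "p x \<in> S" and pR: "x - p x \<in> R" for x by metis
  have p_eqI: "p x = s" if "s \<in> S" "x - s \<in> R" for x s
  proof -
    have "p x - s \<in> S" using pS that(1) by (rule subspace_diff[OF sS])
    moreover have "p x - s \<in> R" using subspace_diff[OF sR that(2) pR[of x]] by simp
    ultimately have "p x - s = 0" using SR by blast
    then show ?thesis by simp
  qed
  have p_add: "p (x + y) = p x + p y" for x y
    using subspace_add[OF sR pR[of x] pR[of y]]
    by (intro p_eqI subspace_add[OF sS] pS) (simp add: algebra_simps)
  have p_scale: "p (scale c x) = scale c (p x)" for c x
    using subspace_scale[OF sR pR[of x], of c]
    by (intro p_eqI subspace_scale[OF sS] pS) (simp add: algebra_simps)
  define q where "q x = x - p x" for x
  have qR: "q x \<in> R" for x unfolding q_def by (rule pR)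
  have x_pq: "x = p x + q x" for x unfolding q_def by simp
  have q_add: "q (x + y) = q x + q y" and q_scale: "q (scale c x) = scale c (q x)" for x y c
    unfolding q_def by (simp_all add: p_add p_scale algebra_simps)
  have br_split: "br x y = br (p x) (p y) + (br (p x) (q y) - br (p y) (q x) + br (q x) (q y))" for x y
  proof -
    have "br x y = br (p x + q x) (p y + q y)" using x_pq by simp
    then show ?thesis using br_commute[of "p y" "q x"]
      by (simp add: br_add_left br_add_right add.assoc)
  qed
  have "br (p x) (q y) - br (p y) (q x) + br (q x) (q y) \<in> R" for x y
    by (intro subspace_add[OF sR] subspace_diff[OF sR] lie_ideal_br[OF R] qR)
  then have p_br: "p (br x y) = br (p x) (p y)" for x y
    using br_split[of x y] by (intro p_eqI lie_subalgebra_br[OF S] pS) simp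
  have q_br: "q (br x y) = br (p x) (q y) - br (p y) (q x) + br (q x) (q y)" for x y
    unfolding q_def[of "br x y"] p_br using br_split[of x y] by simp
  note qf = qform_qclass[OF R sub, folded W_def]
  \<comment> \<open>The functional is zero outside \<open>S\<close>, as \<open>dual_space\<close>
    requires.\<close>
  define f where "f x = (p x, qclass W (q x), \<lambda>c. if c \<in> S then phi (q x) c else 0)" for x
  have f_carrier: "f x \<in> dext_carrier scale S (quotient_space R W)" for x
    unfolding f_def dext_carrier_def dual_space_def quotient_space_def
    using pS qR by (auto simp: phi_add_right phi_scale_right subspace_add[OF sS] subspace_scale[OF sS])
  have f_add: "f (x + y) = dext_add qadd (f x) (f y)" for x y
    unfolding f_def dext_add_def
    by (simp add: p_add q_add qadd_qclass[OF sW] phi_add_left fun_eq_iff)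
  have f_scale: "f (scale c x) = dext_scale scale (qscale scale W) c (f x)" for c x
    unfolding f_def dext_scale_def
    by (simp add: p_scale q_scale qscale_qclass[OF sW] phi_scale_left fun_eq_iff)
  have f_br: "f (br x y) =
      dext_br S br qadd (qneg scale W) (qbr br W) (qform phi) (PhiS br W) (f x) (f y)" for x y
  proof -
    \<comment> \<open>This is the dual component: the bracket of \<open>q x\<close> and
      \<open>q y\<close> yields the cocycle w, and invariance turns the two mixed brackets into the
      coadjoint terms.\<close>
    have "phi (q (br x y)) c = qform phi (PhiS br W c (qclass W (q x))) (qclass W (q y)) +
        phi (q x) (br (p y) c) - phi (q y) (br (p x) c)" for c
    proof -
      have "phi (br (q x) (q y)) c = phi (br c (q x)) (q y)"
      proof -
        have "phi (br (q x) (q y)) c = - phi (q y) (br (q x) c)" by (rule phi_invariant)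
        also have "\<dots> = phi (q y) (br c (q x))"
          unfolding br_commute[of "q x" c] using phi_diff_right[of "q y" 0 "br c (q x)"] by simp
        finally show ?thesis by (simp add: phi_commute[of _ "q y"])
      qed
      then show ?thesis
        by (simp add: q_br PhiS_qclass[OF W] qf lie_ideal_br[OF R] qR phi_add_left phi_diff_left phi_invariant)
    qed
    then show ?thesis
      unfolding f_def dext_br_def
      by (simp add: p_br fun_eq_iff lie_subalgebra_br[OF S pS])
        (simp add: q_br PhiS_qclass[OF W] qneg_qclass[OF sW] qbr_qclass[OF W] qadd_qclass[OF sW])
  qed
  have f_form: "dext_form (qform phi) (f x) (f y) + S_part_form phi (f x) (f y) = phi x y" for x y
  proof -
    have "phi x y = phi (p x + q x) (p y + q y)" using x_pq by simp
    also have "\<dots> = phi (q x) (p y) + phi (q y) (p x) + phi (q x) (q y) + phi (p x) (p y)"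
      by (simp add: phi_add_left phi_add_right phi_commute[of "p x" "q y"])
    finally show ?thesis
      unfolding f_def dext_form_def S_part_form_def by (simp add: qf qR pS)
  qed
  have "inj f"
  proof (rule injI)
    fix x y assume "f x = f y"
    then have p: "p x = p y" and c: "qclass W (q x) = qclass W (q y)"
      and b: "\<And>c. c \<in> S \<Longrightarrow> phi (q x) c = phi (q y) c"
      unfolding f_def by (auto simp: fun_eq_iff split: if_splits)
    have w: "q x - q y \<in> W" using c qclass_eq_iff[OF sW] by simp
    \<comment> \<open>Equal cosets pair equally with \<open>R\<close> and equal functionals pair
      equally with \<open>S\<close>; together these exhaust the algebra.\<close>
    have "q x - q y = 0"
    proof (rule phi_nondegenerate)
      fix z
      have "phi (q x - q y) (q z) = 0" using w qR unfolding W_def orth_def by simp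
      moreover have "phi (q x - q y) (p z) = 0" using b[OF pS] by (simp add: phi_diff_left)
      ultimately show "phi (q x - q y) z = 0" using phi_add_right[of "q x - q y" "p z" "q z"] x_pq[of z] by simp
    qed
    then show "x = y" using p x_pq[of x] x_pq[of y] by simp
  qed
  moreover have "range f = dext_carrier scale S (quotient_space R W)"
  proof (intro equalityI subsetI)
    fix t assume "t \<in> dext_carrier scale S (quotient_space R W)"
    then obtain s r \<beta> where t: "t = (s, qclass W r, \<beta>)" and s: "s \<in> S" and r: "r \<in> R"
      and \<beta>: "\<beta> \<in> dual_space scale S"
      unfolding dext_carrier_def quotient_space_def by auto
    have \<beta>_add: "\<And>x y. x \<in> S \<Longrightarrow> y \<in> S \<Longrightarrow> \<beta> (x + y) = \<beta> x + \<beta> y"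
      and \<beta>_scale: "\<And>c x. x \<in> S \<Longrightarrow> \<beta> (scale c x) = c * \<beta> x" and \<beta>_out: "\<And>x. x \<notin> S \<Longrightarrow> \<beta> x = 0"
      using \<beta> unfolding dual_space_def by auto
    \<comment> \<open>A preimage of \<open>t\<close> is sought as \<open>s + r\<close> plus a
      correction \<open>u\<close> in \<open>W\<close> that adjusts the functional on
      \<open>S\<close>. The needed adjustment is extended by zero along \<open>R\<close> through
      \<open>p\<close>, so the \<open>u\<close> representing it is orthogonal to
      \<open>R\<close>.\<close>
    let ?g = "\<lambda>x. \<beta> (p x) - phi r (p x)"
    have g: "Vector_Spaces.linear scale (*) ?g"
      using linear_phi[of 0] unfolding Vector_Spaces.linear_iff
      by (simp add: p_add p_scale \<beta>_add[OF pS pS] \<beta>_scale[OF pS] phi_add_right phi_scale_right right_diff_distrib)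
    have "\<exists>u\<in>UNIV. \<forall>x\<in>UNIV. ?g x = phi u x"
    proof (rule functional_representable[OF subspace_UNIV linear_phi phi_commute g])
      fix x assume "\<forall>y\<in>UNIV. phi y x = 0"
      then have "x = 0" by (intro phi_nondegenerate) (simp add: phi_commute[of x])
      moreover have "p 0 = 0" by (rule p_eqI) (use subspace_0[OF sS] subspace_0[OF sR] in auto)
      moreover have "\<beta> 0 = 0" using \<beta>_scale[OF s, of 0] by simp
      ultimately show "?g x = 0" by simp
    qed
    then obtain u where u: "\<And>x. \<beta> (p x) - phi r (p x) = phi u x" by auto
    have p_R: "p x = 0" if "x \<in> R" for x by (rule p_eqI) (use that subspace_0[OF sS] in auto)
    have p_S: "p x = x" if "x \<in> S" for x by (rule p_eqI) (use that subspace_0[OF sR] in auto)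
    have "\<beta> 0 = 0" using \<beta>_scale[OF s, of 0] by simp
    then have uW: "u \<in> W" unfolding W_def orth_def using u p_R by (auto simp flip: u)
    then have "u \<in> R" using sub unfolding W_def by auto
    define x where "x = s + (r + u)"
    have px: "p x = s"
      by (rule p_eqI) (use s r \<open>u \<in> R\<close> in \<open>simp_all add: x_def subspace_add[OF sR]\<close>)
    then have qx: "q x = r + u" unfolding q_def by (simp add: x_def)
    have "qclass W (q x) = qclass W r" using uW by (simp add: qx qclass_eq_iff[OF sW])
    moreover have "(\<lambda>c. if c \<in> S then phi (q x) c else 0) = \<beta>"
    proof
      fix c
      show "(if c \<in> S then phi (q x) c else 0) = \<beta> c"
        using u[of c] p_S[of c] \<beta>_out[of c] by (auto simp: qx phi_add_left diff_eq_eq)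
    qed
    ultimately have "f x = t" unfolding f_def t px by simp
    then show "t \<in> range f" by blast
  qed (use f_carrier in auto)
  ultimately have "bij_betw f UNIV (dext_carrier scale S (quotient_space R W))"
    unfolding bij_betw_def by blast
  then show ?thesis using f_add f_scale f_br f_form by blast
qed

end

theorem theorem3p2:
  fixes scale :: "'k::field_char_0 \<Rightarrow> 'v::ab_group_add \<Rightarrow> 'v"
    and br :: "'v \<Rightarrow> 'v \<Rightarrow> 'v"
    and phi :: "'v \<Rightarrow> 'v \<Rightarrow> 'k"
    and R S :: "'v set"
  assumes fd: "fin_dim scale"
    and quad: "quadratic_lie_algebra scale br phi"
    and no_simple: "\<not> (\<exists>I. simple_ideal scale br I)"
    and rad: "is_solvable_radical scale br R"
    and levi: "is_levi_factor scale br R S"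
  shows
    "orth phi R \<subseteq> R \<and>
     (let W = orth phi R; Q = quotient_space R W in
       (\<forall>a\<in>S. \<forall>X\<in>Q. PhiS br W a X \<in> Q) \<and>
       (\<forall>a\<in>S. \<forall>X\<in>Q. \<forall>Y\<in>Q. PhiS br W a (qadd X Y) = qadd (PhiS br W a X) (PhiS br W a Y)) \<and>
       (\<forall>a\<in>S. \<forall>c. \<forall>X\<in>Q. PhiS br W a (qscale scale W c X) = qscale scale W c (PhiS br W a X)) \<and>
       (\<forall>a\<in>S. \<forall>X\<in>Q. \<forall>Y\<in>Q. PhiS br W a (qbr br W X Y)
            = qadd (qbr br W (PhiS br W a X) Y) (qbr br W X (PhiS br W a Y))) \<and>
       (\<forall>a\<in>S. \<forall>X\<in>Q. \<forall>Y\<in>Q. qform phi (PhiS br W a X) Y + qform phi X (PhiS br W a Y) = 0) \<and>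
       (\<forall>a\<in>S. \<forall>b\<in>S. \<forall>X\<in>Q. PhiS br W (a + b) X = qadd (PhiS br W a X) (PhiS br W b X)) \<and>
       (\<forall>a\<in>S. \<forall>c. \<forall>X\<in>Q. PhiS br W (scale c a) X = qscale scale W c (PhiS br W a X)) \<and>
       (\<forall>a\<in>S. \<forall>b\<in>S. \<forall>X\<in>Q. PhiS br W (br a b) X
            = qadd (PhiS br W a (PhiS br W b X)) (qneg scale W (PhiS br W b (PhiS br W a X)))) \<and>
       (\<exists>f. bij_betw f UNIV (dext_carrier scale S Q) \<and>
          (\<forall>x y. f (x + y) = dext_add qadd (f x) (f y)) \<and>
          (\<forall>c x. f (scale c x) = dext_scale scale (qscale scale W) c (f x)) \<and>
          (\<forall>x y. f (br x y) = dext_br S br qadd (qneg scale W) (qbr br W) (qform phi) (PhiS br W)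
                                 (f x) (f y))) \<and>
       (\<exists>f. bij_betw f UNIV (dext_carrier scale S Q) \<and>
          (\<forall>x y. f (x + y) = dext_add qadd (f x) (f y)) \<and>
          (\<forall>c x. f (scale c x) = dext_scale scale (qscale scale W) c (f x)) \<and>
          (\<forall>x y. f (br x y) = dext_br S br qadd (qneg scale W) (qbr br W) (qform phi) (PhiS br W)
                                 (f x) (f y)) \<and>
          (\<forall>x y. dext_form (qform phi) (f x) (f y) + S_part_form phi (f x) (f y) = phi x y)))"
proof -
  interpret fin_dim_quadratic_lie_algebra scale br phi
    by unfold_locales (use fd quad in \<open>auto simp: quadratic_lie_algebra_def\<close>)
  have R: "lie_ideal scale br R" using rad unfolding is_solvable_radical_def by simp
  have sub: "orth phi R \<subseteq> R" by (rule orth_radical_subset[OF no_simple rad])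
  note W = lie_ideal_orth[OF R]
  \<comment> \<open>These rules reduce all claims about the action to representatives in
    \<open>R\<close>, where only linearity, the Jacobi identity and invariance remain.\<close>
  note q = PhiS_qclass[OF W] qadd_qclass[OF lie_ideal_subspace[OF W]]
    qscale_qclass[OF lie_ideal_subspace[OF W]] qneg_qclass[OF lie_ideal_subspace[OF W]]
    qbr_qclass[OF W] qform_qclass[OF R sub] lie_ideal_br[OF R]
  note iso = double_extension_isomorphism[OF R sub levi]
  show ?thesis
    unfolding Let_def
  proof (intro conjI)
    show "orth phi R \<subseteq> R" by (rule sub)
  next
    show "\<exists>f. bij_betw f UNIV (dext_carrier scale S (quotient_space R (orth phi R))) \<and>
        (\<forall>x y. f (x + y) = dext_add qadd (f x) (f y)) \<and>
        (\<forall>c x. f (scale c x) = dext_scale scale (qscale scale (orth phi R)) c (f x)) \<and>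
        (\<forall>x y. f (br x y) = dext_br S br qadd (qneg scale (orth phi R)) (qbr br (orth phi R))
          (qform phi) (PhiS br (orth phi R)) (f x) (f y))"
      using iso by blast
  next
    show "\<exists>f. bij_betw f UNIV (dext_carrier scale S (quotient_space R (orth phi R))) \<and>
        (\<forall>x y. f (x + y) = dext_add qadd (f x) (f y)) \<and>
        (\<forall>c x. f (scale c x) = dext_scale scale (qscale scale (orth phi R)) c (f x)) \<and>
        (\<forall>x y. f (br x y) = dext_br S br qadd (qneg scale (orth phi R)) (qbr br (orth phi R))
          (qform phi) (PhiS br (orth phi R)) (f x) (f y)) \<and>
        (\<forall>x y. dext_form (qform phi) (f x) (f y) + S_part_form phi (f x) (f y) = phi x y)"
      by (rule iso)
  qed (auto simp: quotient_space_def q br_add_left br_add_right br_scale_left br_scale_right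
      br_br_left phi_invariant)
qed

end
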